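(* Let $G$ be a finite non-abelian group with $G/Z(G) \cong D_{2n}$, where $n \ge 3$ and $D_{2n}$ is the dihedral group of order $2n$, and let $z = |Z(G)|$. Let $\Gamma_G$ be the commuting conjugacy class graph of $G$. Then: (1) $\Gamma_G$ is CNL-borderenergetic if $n \in \{3, 11\}$ and $z = 1$. (2) $\Gamma_G$ is CNL-hyperenergetic, except in the cases of (1) and the following cases (in which it is not CNL-hyperenergetic): $n \in\{4,6\}$ and $z=2$; $n = 4$ and $z = 3$; $n=4$ and $z=4$; $n=3$ and $z\ge 2$; $n\in\{5,7,9\}$ and $z=1$; $n=5$ and $z\in\{2,3\}$. (3) $\Gamma_G$ is CNSL-borderenergetic if $n = 3$ and $z = 1$. (4) $\Gamma_G$ is CNSL-hyperenergetic, except in the case of (3) and the following cases (in which it is not CNSL-hyperenergetic): $n = 4$ and $z\in\{2,3,4,5\}$; $n\in\{6,8\}$ and $z=2$; $n=6$ and $z=3$; $n=5$ and $z=1$; $n=3$ and $z\ge 2$; $n\ge 7$ odd and $z=1$; $n\in\{5,7,9\}$ and $z=2$; $n=5$ and $z\in\{3,4\}$.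
   Context: For a finite non-abelian group $G$ with center $Z(G)$, the commuting conjugacy class graph (CCC-graph) $\Gamma_G$ is the simple undirected graph whose vertices are the conjugacy classes $x^G$ of non-central elements $x \in G \setminus Z(G)$; two distinct vertices $x^G, y^G$ are adjacent if there exist $x' \in x^G$ and $y' \in y^G$ with $x'y' = y'x'$. For a finite simple graph $\mathcal{G}$ with vertices $v_1,\dots,v_N$, let $CN(\mathcal{G})$ be the $N\times N$ matrix whose $(i,j)$ entry is, for $i\ne j$, the number of vertices other than $v_i,v_j$ adjacent to both $v_i$ and $v_j$, and whose diagonal entries are $0$. Let $CNRS(\mathcal{G})$ be the diagonal matrix whose $i$-th diagonal entry is the $i$-th row sum of $CN(\mathcal{G})$. Put $CNL(\mathcal{G}) = CNRS(\mathcal{G}) - CN(\mathcal{G})$, $CNSL(\mathcal{G}) = CNRS(\mathcal{G}) + CN(\mathcal{G})$ and $\Delta(\mathcal{G}) = \operatorname{tr}(CNRS(\mathcal{G}))/N$. Then $LE_{CN}(\mathcal{G}) = \sum_{\alpha} |\alpha - \Delta(\mathcal{G})|$ over all eigenvalues $\alpha$ of $CNL(\mathcal{G})$ with multiplicity, and $LE^+_{CN}(\mathcal{G}) = \sum_{\beta} |\beta - \Delta(\mathcal{G})|$ over all eigenvalues $\beta$ of $CNSL(\mathcal{G})$ with multiplicity. A graph $\mathcal{G}$ of order $N$ is CNL-hyperenergetic (respectively CNL-borderenergetic) if $LE_{CN}(\mathcal{G}) > 2(N-1)(N-2)$ (respectively $LE_{CN}(\mathcal{G}) = 2(N-1)(N-2)$),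 and CNSL-hyperenergetic (respectively CNSL-borderenergetic) if $LE^+_{CN}(\mathcal{G}) > 2(N-1)(N-2)$ (respectively $LE^+_{CN}(\mathcal{G}) = 2(N-1)(N-2)$). *)

theory Defs
  imports
    "Jordan_Normal_Form.Char_Poly"
    "Graph_Theory.Pair_Digraph"
    "HOL-Algebra.Group_Action"
    "HOL-Combinatorics.Permutations"
begin

section \<open>Groups\<close>

definition group_center :: "('a, 'b) monoid_scheme \<Rightarrow> 'a set" where
  "group_center G = {c \<in> carrier G. \<forall>x \<in> carrier G. c \<otimes>\<^bsub>G\<^esub> x = x \<otimes>\<^bsub>G\<^esub> c}"

definition conj_class :: "('a, 'b) monoid_scheme \<Rightarrow> 'a \<Rightarrow> 'a set" where
  "conj_class G x = orbit G (\<lambda>g. \<lambda>h \<in> carrier G. g \<otimes>\<^bsub>G\<^esub> h \<otimes>\<^bsub>G\<^esub> inv\<^bsub>G\<^esub> g) x"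

text \<open>
  The dihedral group of order \<open>2n\<close>: the pair \<open>(i, b)\<close> stands for \<open>r^i\<close> (if \<open>b\<close> is false) or
  \<open>r^i s\<close> (if \<open>b\<close> is true), where \<open>r^n = s^2 = 1\<close> and \<open>s r = r^(-1) s\<close>.
\<close>

definition dihedral_group :: "nat \<Rightarrow> (int \<times> bool) monoid" where
  "dihedral_group n =
    \<lparr> carrier = {0..<int n} \<times> UNIV,
      monoid.mult = (\<lambda>(i, b) (j, c). ((if b then i - j else i + j) mod int n, b \<noteq> c)),
      one = (0, False) \<rparr>"

lemma group_dihedral_group:
  assumes "n > 0"
  shows "group (dihedral_group n)"
proof (rule groupI)
  fix x y z
  assume "x \<in> carrier (dihedral_group n)" "y \<in> carrier (dihedral_group n)"
    "z \<in> carrier (dihedral_group n)"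
  then show "x \<otimes>\<^bsub>dihedral_group n\<^esub> y \<otimes>\<^bsub>dihedral_group n\<^esub> z =
      x \<otimes>\<^bsub>dihedral_group n\<^esub> (y \<otimes>\<^bsub>dihedral_group n\<^esub> z)"
    by (cases x; cases y; cases z)
       (auto simp: dihedral_group_def mod_simps algebra_simps)
next
  fix x
  assume x: "x \<in> carrier (dihedral_group n)"
  obtain i b where ib: "x = (i, b)" by (cases x)
  let ?y = "if b then x else ((- i) mod int n, False)"
  have "?y \<in> carrier (dihedral_group n)"
    using x assms by (auto simp: dihedral_group_def ib)
  moreover have "?y \<otimes>\<^bsub>dihedral_group n\<^esub> x = \<one>\<^bsub>dihedral_group n\<^esub>"
    by (auto simp: dihedral_group_def ib mod_simps)
  ultimately show "\<exists>y \<in> carrier (dihedral_group n).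
      y \<otimes>\<^bsub>dihedral_group n\<^esub> x = \<one>\<^bsub>dihedral_group n\<^esub>"
    by blast
qed (use assms in \<open>auto simp: dihedral_group_def\<close>)

lemma card_dihedral_group: "card (carrier (dihedral_group n)) = 2 * n"
  by (simp add: dihedral_group_def card_cartesian_product)


section \<open>The commuting conjugacy class graph\<close>

text \<open>
  Simple undirected graphs are rendered as in \<open>Graph_Theory\<close>: an edge is a pair of opposite arcs,
  see the locale \<open>pair_graph\<close>.
\<close>

definition ccc_graph :: "('a, 'b) monoid_scheme \<Rightarrow> 'a set pair_pre_digraph" where
  "ccc_graph G =
    \<lparr> pverts = conj_class G ` (carrier G - group_center G),
      parcs = {(X, Y).
        X \<in> conj_class G ` (carrier G - group_center G) \<and>
        Y \<in> conj_class G ` (carrier G - group_center G) \<and> X \<noteq> Y \<and>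
        (\<exists>x' \<in> X. \<exists>y' \<in> Y. x' \<otimes>\<^bsub>G\<^esub> y' = y' \<otimes>\<^bsub>G\<^esub> x')} \<rparr>"

lemma pair_graph_ccc_graph:
  assumes "finite (carrier G)"
  shows "pair_graph (ccc_graph G)"
proof
  show "finite (pverts (ccc_graph G))"
    using assms by (simp add: ccc_graph_def)
  show "finite (parcs (ccc_graph G))"
    by (rule finite_subset[where B = "pverts (ccc_graph G) \<times> pverts (ccc_graph G)"])
       (use assms in \<open>auto simp: ccc_graph_def\<close>)
  show "symmetric (ccc_graph G)"
    unfolding symmetric_def sym_def by (auto simp: ccc_graph_def) metis+
qed (auto simp: ccc_graph_def)


section \<open>Common neighbourhood matrices\<close>

text \<open>The matrices depend on an enumeration \<open>vs\<close> of the vertices.\<close>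

definition CN :: "'v pair_pre_digraph \<Rightarrow> 'v list \<Rightarrow> real mat" where
  "CN \<G> vs = mat (length vs) (length vs) (\<lambda>(i, j).
     if i = j then 0
     else real (card {w \<in> pverts \<G>. w \<noteq> vs ! i \<and> w \<noteq> vs ! j \<and>
       (vs ! i, w) \<in> parcs \<G> \<and> (vs ! j, w) \<in> parcs \<G>}))"

definition CNRS :: "'v pair_pre_digraph \<Rightarrow> 'v list \<Rightarrow> real mat" where
  "CNRS \<G> vs = mat_diag (length vs) (\<lambda>i. \<Sum>j<length vs. CN \<G> vs $$ (i, j))"

definition CNL :: "'v pair_pre_digraph \<Rightarrow> 'v list \<Rightarrow> real mat" where
  "CNL \<G> vs = CNRS \<G> vs - CN \<G> vs"

definition CNSL :: "'v pair_pre_digraph \<Rightarrow> 'v list \<Rightarrow> real mat" where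
  "CNSL \<G> vs = CNRS \<G> vs + CN \<G> vs"

definition CN_Delta :: "'v pair_pre_digraph \<Rightarrow> 'v list \<Rightarrow> real" where
  "CN_Delta \<G> vs = sum_list (diag_mat (CNRS \<G> vs)) / real (length vs)"

text \<open>
  The sum of \<open>\<bar>\<alpha> - d\<bar>\<close> over all eigenvalues \<open>\<alpha>\<close> of \<open>A\<close> with (algebraic) multiplicity. It is applied
  to real symmetric matrices only, all of whose eigenvalues are real.
\<close>

definition spectral_deviation :: "real mat \<Rightarrow> real \<Rightarrow> real" where
  "spectral_deviation A d =
     (\<Sum>\<alpha> | eigenvalue A \<alpha>. real (Polynomial.order \<alpha> (char_poly A)) * \<bar>\<alpha> - d\<bar>)"

definition vertex_enum :: "'v pair_pre_digraph \<Rightarrow> 'v list" where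
  "vertex_enum \<G> = (SOME vs. distinct vs \<and> set vs = pverts \<G>)"

text \<open>
  The choice of the enumeration is immaterial, see \<open>LE_CN_eq\<close> and \<open>LE_CN_plus_eq\<close> below.
\<close>

definition LE_CN :: "'v pair_pre_digraph \<Rightarrow> real" where
  "LE_CN \<G> = (let vs = vertex_enum \<G> in spectral_deviation (CNL \<G> vs) (CN_Delta \<G> vs))"

definition LE_CN_plus :: "'v pair_pre_digraph \<Rightarrow> real" where
  "LE_CN_plus \<G> = (let vs = vertex_enum \<G> in spectral_deviation (CNSL \<G> vs) (CN_Delta \<G> vs))"

definition CNL_hyperenergetic :: "'v pair_pre_digraph \<Rightarrow> bool" where
  "CNL_hyperenergetic \<G> \<longleftrightarrow>
     LE_CN \<G> > 2 * (real (card (pverts \<G>)) - 1) * (real (card (pverts \<G>)) - 2)"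

definition CNL_borderenergetic :: "'v pair_pre_digraph \<Rightarrow> bool" where
  "CNL_borderenergetic \<G> \<longleftrightarrow>
     LE_CN \<G> = 2 * (real (card (pverts \<G>)) - 1) * (real (card (pverts \<G>)) - 2)"

definition CNSL_hyperenergetic :: "'v pair_pre_digraph \<Rightarrow> bool" where
  "CNSL_hyperenergetic \<G> \<longleftrightarrow>
     LE_CN_plus \<G> > 2 * (real (card (pverts \<G>)) - 1) * (real (card (pverts \<G>)) - 2)"

definition CNSL_borderenergetic :: "'v pair_pre_digraph \<Rightarrow> bool" where
  "CNSL_borderenergetic \<G> \<longleftrightarrow>
     LE_CN_plus \<G> = 2 * (real (card (pverts \<G>)) - 1) * (real (card (pverts \<G>)) - 2)"


section \<open>Independence of the enumeration\<close>

lemma char_poly_permute: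
  fixes A :: "'a :: comm_ring_1 mat"
  assumes A: "A \<in> carrier_mat n n" and p: "p permutes {0..<n}"
  shows "char_poly (mat n n (\<lambda>(i, j). A $$ (p i, p j))) = char_poly A"
proof -
  define C where "C = char_poly_matrix A"
  define D where "D = mat n n (\<lambda>(i, j). C $$ (p i, j))"
  have C: "C \<in> carrier_mat n n" using A by (simp add: C_def)
  have D: "D \<in> carrier_mat n n" by (simp add: D_def)
  have pn: "p i < n" if "i < n" for i
    using permutes_in_image[OF p, of i] that by simp
  have pinj: "p i = p j \<longleftrightarrow> i = j" for i j
    using permutes_inj[OF p] by (auto dest: injD)
  have "char_poly_matrix (mat n n (\<lambda>(i, j). A $$ (p i, p j))) =
      transpose_mat (mat n n (\<lambda>(i, j). transpose_mat D $$ (p i, j)))"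
    by (rule eq_matI)
       (use A in \<open>auto simp: D_def C_def char_poly_matrix_def pn pinj\<close>)
  then have "char_poly (mat n n (\<lambda>(i, j). A $$ (p i, p j))) =
      det (transpose_mat (mat n n (\<lambda>(i, j). transpose_mat D $$ (p i, j))))"
    by (simp add: char_poly_def)
  also have "\<dots> = det (mat n n (\<lambda>(i, j). transpose_mat D $$ (p i, j)))"
    by (rule det_transpose[where n = n]) simp
  also have "\<dots> = signof p * det (transpose_mat D)"
    by (rule det_permute_rows[OF _ p]) (use D in simp)
  also have "det (transpose_mat D) = det D" by (rule det_transpose[OF D])
  also have "det D = signof p * det C"
    unfolding D_def by (rule det_permute_rows[OF C p])
  also have "signof p * (signof p * det C) = det C"
    by (simp add: sign_def)
  finally show ?thesis by (simp add: char_poly_def C_def)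
qed

lemma spectral_deviation_permute:
  assumes A: "A \<in> carrier_mat n n" and p: "p permutes {0..<n}"
  shows "spectral_deviation (mat n n (\<lambda>(i, j). A $$ (p i, p j))) d = spectral_deviation A d"
proof -
  have B: "mat n n (\<lambda>(i, j). A $$ (p i, p j)) \<in> carrier_mat n n" by simp
  show ?thesis
    unfolding spectral_deviation_def eigenvalue_root_char_poly[OF A]
      eigenvalue_root_char_poly[OF B] char_poly_permute[OF A p] ..
qed

lemma CN_matrices_permute:
  assumes "distinct vs" "distinct ws" "set vs = set ws"
  obtains p where "p permutes {0..<length vs}"
    "CNL \<G> ws = mat (length vs) (length vs) (\<lambda>(i, j). CNL \<G> vs $$ (p i, p j))"
    "CNSL \<G> ws = mat (length vs) (length vs) (\<lambda>(i, j). CNSL \<G> vs $$ (p i, p j))"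
    "CN_Delta \<G> ws = CN_Delta \<G> vs"
proof -
  have "mset ws = mset vs"
    using assms set_eq_iff_mset_eq_distinct by metis
  then obtain p where p': "p permutes {..<length vs}" and ws: "permute_list p vs = ws"
    by (rule mset_eq_permutation)
  define n where "n = length vs"
  have p: "p permutes {0..<n}" using p' by (simp add: n_def atLeast0LessThan)
  have len: "length ws = n" using ws by (auto simp: n_def)
  have nth: "ws ! i = vs ! p i" if "i < n" for i
    using permute_list_nth[OF p', of i] that ws by (simp add: n_def)
  have pn: "p i < n" if "i < n" for i
    using permutes_in_image[OF p, of i] that by simp
  have pinj: "p i = p j \<longleftrightarrow> i = j" for i j
    using permutes_inj[OF p] by (auto dest: injD)
  have CN: "CN \<G> ws $$ (i, j) = CN \<G> vs $$ (p i, p j)" if "i < n" "j < n" for i j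
    using that pn by (simp add: CN_def len n_def[symmetric] nth pinj)
  have row: "(\<Sum>j<n. CN \<G> ws $$ (i, j)) = (\<Sum>j<n. CN \<G> vs $$ (p i, j))" if "i < n" for i
  proof -
    have "(\<Sum>j<n. CN \<G> ws $$ (i, j)) = (\<Sum>j<n. CN \<G> vs $$ (p i, p j))"
      using that by (intro sum.cong) (auto simp: CN)
    also have "\<dots> = (\<Sum>j<n. CN \<G> vs $$ (p i, j))"
      using sum.permute[OF p'[folded n_def], of "\<lambda>j. CN \<G> vs $$ (p i, j)"]
      by (simp add: o_def)
    finally show ?thesis .
  qed
  have RS: "CNRS \<G> ws $$ (i, j) = CNRS \<G> vs $$ (p i, p j)" if "i < n" "j < n" for i j
    using that pn by (simp add: CNRS_def mat_diag_def len n_def[symmetric] row pinj)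
  have dims: "CN \<G> us \<in> carrier_mat (length us) (length us)"
    "CNRS \<G> us \<in> carrier_mat (length us) (length us)" for us
    by (simp_all add: CN_def CNRS_def)
  note dims = dims[THEN carrier_matD(1)] dims[THEN carrier_matD(2)]
  have diag: "sum_list (diag_mat (CNRS \<G> us)) = (\<Sum>i<length us. CNRS \<G> us $$ (i, i))" for us
    unfolding diag_mat_def dims by (simp add: interv_sum_list_conv_sum_set_nat atLeast0LessThan)
  have "(\<Sum>i<n. CNRS \<G> ws $$ (i, i)) = (\<Sum>i<n. CNRS \<G> vs $$ (p i, p i))"
    by (intro sum.cong) (auto simp: RS)
  also have "\<dots> = (\<Sum>i<n. CNRS \<G> vs $$ (i, i))"
    using sum.permute[OF p'[folded n_def], of "\<lambda>i. CNRS \<G> vs $$ (i, i)"] by (simp add: o_def)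
  finally have "CN_Delta \<G> ws = CN_Delta \<G> vs"
    unfolding CN_Delta_def diag len n_def[symmetric] by simp
  moreover have "CNL \<G> ws = mat n n (\<lambda>(i, j). CNL \<G> vs $$ (p i, p j))"
    by (rule eq_matI) (auto simp: CNL_def dims len n_def[symmetric] CN RS pn)
  moreover have "CNSL \<G> ws = mat n n (\<lambda>(i, j). CNSL \<G> vs $$ (p i, p j))"
    by (rule eq_matI) (auto simp: CNSL_def dims len n_def[symmetric] CN RS pn)
  ultimately show ?thesis using that p by (simp add: n_def)
qed

lemma vertex_enum:
  assumes "finite (pverts \<G>)"
  shows "distinct (vertex_enum \<G>)" "set (vertex_enum \<G>) = pverts \<G>"
  using someI_ex[of "\<lambda>vs. distinct vs \<and> set vs = pverts \<G>"] finite_distinct_list[OF assms]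
  unfolding vertex_enum_def by blast+

lemma LE_CN_eq:
  assumes "distinct vs" "set vs = pverts \<G>"
  shows "LE_CN \<G> = spectral_deviation (CNL \<G> vs) (CN_Delta \<G> vs)"
proof -
  have "finite (pverts \<G>)" using assms by (metis List.finite_set)
  from vertex_enum[OF this] assms obtain p where "p permutes {0..<length vs}"
    "CNL \<G> (vertex_enum \<G>) = mat (length vs) (length vs) (\<lambda>(i, j). CNL \<G> vs $$ (p i, p j))"
    "CN_Delta \<G> (vertex_enum \<G>) = CN_Delta \<G> vs"
    using CN_matrices_permute[of vs "vertex_enum \<G>" \<G>] by metis
  moreover have "CNL \<G> vs \<in> carrier_mat (length vs) (length vs)"
    unfolding CNL_def by (rule minus_carrier_mat) (simp add: CN_def)
  ultimately show ?thesis
    by (simp add: LE_CN_def Let_def spectral_deviation_permute)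
qed

lemma LE_CN_plus_eq:
  assumes "distinct vs" "set vs = pverts \<G>"
  shows "LE_CN_plus \<G> = spectral_deviation (CNSL \<G> vs) (CN_Delta \<G> vs)"
proof -
  have "finite (pverts \<G>)" using assms by (metis List.finite_set)
  from vertex_enum[OF this] assms obtain p where "p permutes {0..<length vs}"
    "CNSL \<G> (vertex_enum \<G>) = mat (length vs) (length vs) (\<lambda>(i, j). CNSL \<G> vs $$ (p i, p j))"
    "CN_Delta \<G> (vertex_enum \<G>) = CN_Delta \<G> vs"
    using CN_matrices_permute[of vs "vertex_enum \<G>" \<G>] by metis
  moreover have "CNSL \<G> vs \<in> carrier_mat (length vs) (length vs)"
    unfolding CNSL_def by (rule add_carrier_mat) (simp add: CN_def)
  ultimately show ?thesis
    by (simp add: LE_CN_plus_def Let_def spectral_deviation_permute)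
qed

end

theory Submission
  imports Defs
begin

text \<open>
  The rotations form an abelian subgroup of index 2 that is the centralizer of each of its
  noncentral elements, and the centralizer of a reflection \<open>x\<close> is \<open>Z \<union> xZ\<close>. So noncentral rotations
  have classes of size \<open>2\<close> and reflections have classes of size \<open>n\<close>, and two classes are adjacent
  iff both consist of rotations or both contain elements of a common fibre of \<open>G \<rightarrow> D\<^sub>2\<^sub>n\<close> over a
  reflection. Hence the graph is \<open>K\<^sub>p \<union> K\<^sub>z\<close> for odd \<open>n\<close> and \<open>K\<^sub>p \<union> 2 K\<^bsub>z/2\<^esub>\<close> for even \<open>n\<close> (which
  forces \<open>z\<close> to be even), where \<open>p = (n - 1) z / 2\<close>. A component \<open>K\<^sub>k\<close> contributes the eigenvalues \<open>0\<close>
  and \<open>k (k - 2)\<close> to \<open>CNL\<close>, and \<open>2 (k - 1) (k - 2)\<close> and \<open>(k - 2)\<^sup>2\<close> to \<open>CNSL\<close>, where the second one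
  has multiplicity \<open>k - 1\<close>. What remains are polynomial inequalities in \<open>n\<close> and \<open>z\<close> outside a
  few boundary cases.
\<close>

section \<open>Spectra of disjoint unions of cliques\<close>

lemma order_prod_linear_factors:
  fixes as :: "'a :: idom list"
  shows "Polynomial.order x (\<Prod>a\<leftarrow>as. [:- a, 1:]) = count_list as x"
proof (induction as)
  case (Cons a as)
  have "(\<Prod>a\<leftarrow>as. [:- a, 1:]) \<noteq> 0" by (auto simp: prod_list_zero_iff)
  then have "Polynomial.order x (\<Prod>a\<leftarrow>a # as. [:- a, 1:]) =
      Polynomial.order x [:- a, 1:] + count_list as x"
    using Cons by (simp add: order_mult del: mult_pCons_left)
  moreover have "Polynomial.order x [:- a, 1:] = (if a = x then 1 else 0)"
    using order_power_n_n[of a 1] by (auto intro: order_0I)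
  ultimately show ?case by simp
qed simp

lemma sum_count_list:
  fixes g :: "'a \<Rightarrow> real"
  shows "(\<Sum>a\<in>set as. real (count_list as a) * g a) = (\<Sum>a\<leftarrow>as. g a)"
proof -
  \<comment> \<open>The index set is enlarged to any fixed finite superset, since
    \<open>set as\<close> itself changes during the induction.\<close>
  have "(\<Sum>a\<in>S. real (count_list as a) * g a) = (\<Sum>a\<leftarrow>as. g a)"
    if "finite S" "set as \<subseteq> S" for S
    using that
  proof (induction as)
    case (Cons b as)
    have "(\<Sum>a\<in>S. real (count_list (b # as) a) * g a) =
        (\<Sum>a\<in>S. (if a = b then g b else 0) + real (count_list as a) * g a)"
      by (rule sum.cong) (auto simp: algebra_simps)
    then show ?case using Cons by (simp add: sum.distrib)
  qed simp
  then show ?thesis by simp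
qed

text \<open>A split characteristic polynomial lets the sum over distinct eigenvalues, weighted by
  multiplicity, run over the list of roots instead. Coincidences between eigenvalues of different
  blocks then need no case distinction.\<close>

lemma spectral_deviation_linear_factors:
  assumes A: "A \<in> carrier_mat n n" and char: "char_poly A = (\<Prod>a\<leftarrow>as. [:- a, 1:])"
  shows "spectral_deviation A d = (\<Sum>a\<leftarrow>as. \<bar>a - d\<bar>)"
proof -
  have "poly (\<Prod>a\<leftarrow>as. [:- a, 1:]) x = 0 \<longleftrightarrow> x \<in> set as" for x
    by (induction as) auto
  then have "{\<alpha>. eigenvalue A \<alpha>} = set as"
    unfolding eigenvalue_root_char_poly[OF A] char by simp
  then show ?thesis
    unfolding spectral_deviation_def
    by (simp add: char order_prod_linear_factors sum_count_list)
qed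

text \<open>
  Adding to the column of the first index of each block all other columns of that block, and
  undoing this on the rows, makes the matrix upper triangular.
\<close>

lemma char_poly_block_matrix:
  fixes f :: "nat \<Rightarrow> 'c" and a b :: "'c \<Rightarrow> real" and N :: nat
  defines "A \<equiv> mat N N (\<lambda>(i, j). (if i = j then a (f i) else 0) + (if f i = f j then b (f i) else 0))"
    and "r \<equiv> \<lambda>i. LEAST j. f j = f i"
  shows "char_poly A = (\<Prod>x\<leftarrow>map (\<lambda>i. if r i = i
    then a (f i) + real (card {j\<in>{..<N}. f j = f i}) * b (f i) else a (f i)) [0..<N]. [:- x, 1:])"
proof -
  define e where "e = (\<lambda>i. if r i = i
    then a (f i) + real (card {j\<in>{..<N}. f j = f i}) * b (f i) else a (f i))"
  have fr: "f (r i) = f i" for i unfolding r_def by (rule LeastI) simp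
  have rle: "r i \<le> i" for i unfolding r_def by (rule Least_le) simp
  have req: "r i = r j \<longleftrightarrow> f i = f j" for i j
    using fr by (metis r_def)
  have rr [simp]: "r (r i) = r i" for i by (simp add: req fr)
  have rN: "r i < N" if "i < N" for i using rle[of i] that by simp
  \<comment> \<open>Here \<open>r i\<close> is the first index of the block of \<open>i\<close>. Off
    the diagonal, \<open>B\<close> is supported at positions \<open>(r j, j)\<close> with
    \<open>r j < j\<close>, so it is upper triangular with diagonal \<open>e\<close>.\<close>
  define B where "B = mat N N (\<lambda>(i, j). (if i = j then e i else 0) +
    (if r j \<noteq> j \<and> i = r j then b (f j) else 0))"
  define T where "T = (\<lambda>s :: real. mat N N (\<lambda>(i, j). (if i = j then 1 else 0) +
    (if r i \<noteq> i \<and> j = r i then s else 0)))"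
  have carr: "A \<in> carrier_mat N N" "B \<in> carrier_mat N N" "T s \<in> carrier_mat N N" for s
    by (simp_all add: A_def B_def T_def)
  have left: "(T s * M) $$ (i, j) = M $$ (i, j) + (if r i \<noteq> i then s * M $$ (r i, j) else 0)"
    if "M \<in> carrier_mat N N" "i < N" "j < N" for s M i j
  proof -
    have "(T s * M) $$ (i, j) = (\<Sum>l<N. ((if i = l then 1 else 0) +
        (if r i \<noteq> i \<and> l = r i then s else 0)) * M $$ (l, j))"
      using that by (simp add: T_def scalar_prod_def atLeast0LessThan)
    also have "\<dots> = (\<Sum>l<N. if l = i then M $$ (i, j) else 0) +
        (\<Sum>l<N. if l = r i then (if r i \<noteq> i then s * M $$ (r i, j) else 0) else 0)"
      unfolding sum.distrib[symmetric] by (rule sum.cong) auto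
    finally show ?thesis using that rN by simp
  qed
  \<comment> \<open>\<open>T s\<close> is \<open>1 + s E\<close> with \<open>E\<close> of square
    zero, because a first index is its own first index.\<close>
  have inverse: "T s * T (- s) = 1\<^sub>m N" for s
  proof (rule eq_matI)
    fix i j assume ij: "i < dim_row (1\<^sub>m N :: real mat)" "j < dim_col (1\<^sub>m N :: real mat)"
    then have "(T s * T (- s)) $$ (i, j) = T (- s) $$ (i, j) +
        (if r i \<noteq> i then s * T (- s) $$ (r i, j) else 0)"
      by (intro left) (auto simp: carr)
    also have "\<dots> = 1\<^sub>m N $$ (i, j)"
      using ij rN by (auto simp: T_def)
    finally show "(T s * T (- s)) $$ (i, j) = 1\<^sub>m N $$ (i, j)" .
  qed (auto simp: T_def)
  have "A * T 1 = T 1 * B"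
  proof (rule eq_matI)
    fix i j assume "i < dim_row (T 1 * B)" "j < dim_col (T 1 * B)"
    then have ij: "i < N" "j < N" by (auto simp: T_def B_def)
    have "(A * T 1) $$ (i, j) = (\<Sum>l<N. A $$ (i, l) * ((if l = j then 1 else 0) +
        (if r l \<noteq> l \<and> j = r l then 1 else 0)))"
      using ij by (simp add: T_def A_def scalar_prod_def atLeast0LessThan)
    also have "\<dots> = (\<Sum>l<N. if r j = j then (if r l = j then A $$ (i, l) else 0)
        else (if l = j then A $$ (i, l) else 0))"
      by (rule sum.cong) auto
    also have "\<dots> = (T 1 * B) $$ (i, j)"
    proof (cases "r j = j")
      case False
      have same: "r i = r j \<longleftrightarrow> f i = f j" by (rule req)
      have "A $$ (i, j) = B $$ (i, j) + (if r i \<noteq> i then B $$ (r i, j) else 0)"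
      proof (cases "r i = i")
        case True
        then have "i = r j \<longleftrightarrow> f i = f j" using same by simp
        then show ?thesis using True False ij by (auto simp: A_def B_def)
      next
        case nonrep: False
        have "i \<noteq> r j" "r i \<noteq> j" using nonrep False by (metis rr)+
        then show ?thesis using nonrep False ij rN[OF ij(1)] same by (simp add: A_def B_def e_def)
      qed
      then show ?thesis
        using False ij unfolding left[OF carr(2) ij] by simp
    next
      case True
      have same: "r l = j \<longleftrightarrow> f l = f j" for l using req[of l j] True by simp
      \<comment> \<open>Summing row \<open>i\<close> of \<open>A\<close> over its own block collects
        \<open>a\<close> once and \<open>b\<close> as often as the block has indices, which is
        \<open>e j\<close>; over any other block the sum is zero.\<close>
      have "(\<Sum>l<N. if r l = j then A $$ (i, l) else 0) =
          (\<Sum>l<N. if l = i then (if f i = f j then a (f i) else 0) else 0) +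
          (\<Sum>l<N. if f l = f j then (if f i = f j then b (f j) else 0) else 0)"
        unfolding sum.distrib[symmetric] by (rule sum.cong) (use ij in \<open>auto simp: A_def same\<close>)
      also have "\<dots> = (if f i = f j then e j else 0)"
        using ij True by (auto simp: e_def sum.If_cases Int_def)
      also have "\<dots> = (T 1 * B) $$ (i, j)"
      proof -
        have "B $$ (l, j) = (if l = j then e j else 0)" if "l < N" for l
          using that ij True by (simp add: B_def)
        then have "(T 1 * B) $$ (i, j) = (if i = j then e j else 0) +
            (if r i \<noteq> i then if r i = j then e j else 0 else 0)"
          unfolding left[OF carr(2) ij] using ij(1) rN[OF ij(1)] by simp
        moreover have "i = j \<Longrightarrow> r i = j" using True by simp
        ultimately show ?thesis unfolding same[symmetric] by auto
      qed
      finally show ?thesis using True by simp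
    qed
    finally show "(A * T 1) $$ (i, j) = (T 1 * B) $$ (i, j)" .
  qed (auto simp: A_def B_def T_def)
  then have "A = T 1 * B * T (- 1)"
    using assoc_mult_mat[OF carr(1) carr(3)[of 1] carr(3)[of "- 1"]] inverse[of 1]
      right_mult_one_mat[OF carr(1)] by simp
  then have "similar_mat_wit A B (T 1) (T (- 1))"
    using inverse[of 1] inverse[of "- 1"] carr by (intro similar_mat_witI) auto
  then have "char_poly A = char_poly B"
    by (intro char_poly_similar) (auto simp: similar_mat_def)
  moreover have "upper_triangular B"
  proof (rule upper_triangularI)
    fix i j assume "j < i" "i < dim_row B"
    then show "B $$ (i, j) = 0" using rle[of j] by (auto simp: B_def)
  qed
  moreover have "diag_mat B = map e [0..<N]"
    by (auto simp: diag_mat_def B_def)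
  ultimately show ?thesis
    using char_poly_upper_triangular[OF carr(2)] unfolding e_def by simp
qed

text \<open>The diagonal of the triangular form is grouped by blocks: the first index of block
  \<open>c\<close> carries the row sum \<open>a c + k c * b c\<close>, and each of the other
  \<open>k c - 1\<close> indices carries \<open>a c\<close>.\<close>

lemma spectral_deviation_block_matrix:
  fixes f :: "nat \<Rightarrow> 'c" and a b :: "'c \<Rightarrow> real"
  assumes "A = mat N N (\<lambda>(i, j). (if i = j then a (f i) else 0) + (if f i = f j then b (f i) else 0))"
    and k: "\<And>c. k c = real (card {j\<in>{..<N}. f j = c})"
  shows "spectral_deviation A d =
    (\<Sum>c\<in>f ` {..<N}. \<bar>a c + k c * b c - d\<bar> + (k c - 1) * \<bar>a c - d\<bar>)"
proof -
  define r where "r = (\<lambda>i. LEAST j. f j = f i)"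
  define g where "g = (\<lambda>i. if r i = i then \<bar>a (f i) + k (f i) * b (f i) - d\<bar> else \<bar>a (f i) - d\<bar>)"
  have fr: "f (r i) = f i" for i unfolding r_def by (rule LeastI) simp
  have rle: "r i \<le> i" for i unfolding r_def by (rule Least_le) simp
  have A: "A \<in> carrier_mat N N" by (simp add: assms)
  have "spectral_deviation A d = (\<Sum>i\<leftarrow>[0..<N]. g i)"
    unfolding spectral_deviation_linear_factors[OF A char_poly_block_matrix[of N a f b, folded assms(1)]]
    by (simp add: g_def r_def k o_def if_distrib[of "\<lambda>x. \<bar>x - d\<bar>"] cong: if_cong)
  also have "\<dots> = (\<Sum>i<N. g i)"
    by (simp add: interv_sum_list_conv_sum_set_nat atLeast0LessThan)
  also have "\<dots> = (\<Sum>c\<in>f ` {..<N}. \<Sum>i | i \<in> {..<N} \<and> f i = c. g i)"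
    by (rule sum.image_gen) simp
  also have "\<dots> = (\<Sum>c\<in>f ` {..<N}. \<bar>a c + k c * b c - d\<bar> + (k c - 1) * \<bar>a c - d\<bar>)"
  proof (rule sum.cong)
    fix c assume "c \<in> f ` {..<N}"
    then obtain i where i: "i < N" "f i = c" by auto
    define C where "C = {j. j \<in> {..<N} \<and> f j = c}"
    have fin: "finite C" by (simp add: C_def)
    have ri: "r i \<in> C" using i rle[of i] fr[of i] by (auto simp: C_def)
    have rC: "r j = r i" if "j \<in> C" for j using that i by (simp add: C_def r_def)
    have "sum g C = g (r i) + sum g (C - {r i})" by (rule sum.remove[OF fin ri])
    also have "sum g (C - {r i}) = (\<Sum>j\<in>C - {r i}. \<bar>a c - d\<bar>)"
      by (rule sum.cong) (auto simp: g_def rC, auto simp: C_def)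
    also have "\<dots> = (k c - 1) * \<bar>a c - d\<bar>"
    proof -
      have "card C > 0" using fin ri by (auto simp: card_gt_0_iff)
      then show ?thesis using fin ri by (simp add: k C_def of_nat_diff)
    qed
    also have "g (r i) = \<bar>a c + k c * b c - d\<bar>"
      using rC[OF ri] ri by (simp add: g_def C_def)
    finally show "(\<Sum>i | i \<in> {..<N} \<and> f i = c. g i) =
        \<bar>a c + k c * b c - d\<bar> + (k c - 1) * \<bar>a c - d\<bar>" by (simp add: C_def)
  qed simp
  finally show ?thesis .
qed

text \<open>The colour \<open>f\<close> names the clique of a vertex. Two vertices of one clique of
  size \<open>k\<close> have the remaining \<open>k - 2\<close> as common neighbours, and vertices
  of different cliques have none. So \<open>CNL\<close> and \<open>CNSL\<close> are block matrices
  of the shape treated above.\<close>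

lemma LE_CN_disjoint_cliques:
  fixes f :: "'v \<Rightarrow> 'c" and \<G> :: "'v pair_pre_digraph"
  assumes fin: "finite (pverts \<G>)"
    and adj: "\<And>u v. u \<in> pverts \<G> \<Longrightarrow> v \<in> pverts \<G> \<Longrightarrow> (u, v) \<in> parcs \<G> \<longleftrightarrow> u \<noteq> v \<and> f u = f v"
    and colours: "f ` pverts \<G> = S"
    and k: "\<And>c. k c = real (card {v \<in> pverts \<G>. f v = c})"
    and d: "d = (\<Sum>c\<in>S. k c * (k c - 1) * (k c - 2)) / (\<Sum>c\<in>S. k c)"
  shows "LE_CN \<G> = (\<Sum>c\<in>S. \<bar>d\<bar> + (k c - 1) * \<bar>k c * (k c - 2) - d\<bar>)"
    and "LE_CN_plus \<G> = (\<Sum>c\<in>S. \<bar>2 * (k c - 1) * (k c - 2) - d\<bar> + (k c - 1) * \<bar>(k c - 2)\<^sup>2 - d\<bar>)"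
    and "real (card (pverts \<G>)) = (\<Sum>c\<in>S. k c)"
proof -
  obtain vs where vs: "distinct vs" "set vs = pverts \<G>"
    using finite_distinct_list[OF fin] by metis
  define N where "N = length vs"
  define F where "F = (\<lambda>i. f (vs ! i))"
  define same where "same = (\<lambda>i. {j\<in>{..<N}. F j = F i})"
  have nth: "vs ! i \<in> pverts \<G>" if "i < N" for i
    using nth_mem[of i vs] that unfolding vs(2) N_def by blast
  have nth_eq: "vs ! i = vs ! j \<longleftrightarrow> i = j" if "i < N" "j < N" for i j
    using that nth_eq_iff_index_eq[OF vs(1)] by (simp add: N_def)
  have bij: "bij_betw ((!) vs) {..<N} (pverts \<G>)"
    using bij_betw_nth[OF vs(1), of "{..<N}"] vs(2) by (simp add: N_def)
  have kF: "k c = real (card {j\<in>{..<N}. F j = c})" for c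
  proof -
    have "bij_betw ((!) vs) {j\<in>{..<N}. F j = c} {v \<in> pverts \<G>. f v = c}"
      using bij unfolding bij_betw_def inj_on_def F_def by auto
    then show ?thesis by (simp add: k bij_betw_same_card)
  qed
  have FS: "F ` {..<N} = S"
    by (simp add: F_def image_image flip: colours bij_betw_imp_surj_on[OF bij])
  have CN: "CN \<G> vs $$ (i, j) = (if i \<noteq> j \<and> F i = F j then k (F i) - 2 else 0)"
    if ij: "i < N" "j < N" for i j
  proof (cases "i = j")
    case True
    then show ?thesis using that by (simp add: CN_def N_def)
  next
    case False
    let ?W = "{w \<in> pverts \<G>. w \<noteq> vs ! i \<and> w \<noteq> vs ! j \<and>
       (vs ! i, w) \<in> parcs \<G> \<and> (vs ! j, w) \<in> parcs \<G>}"
    let ?C = "{v \<in> pverts \<G>. f v = F i}"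
    have W: "?W = {w \<in> pverts \<G>. w \<noteq> vs ! i \<and> w \<noteq> vs ! j \<and> F i = f w \<and> F j = f w}"
      using adj nth ij by (auto simp: F_def)
    show ?thesis
    proof (cases "F i = F j")
      case True
      then have "?W = ?C - {vs ! i, vs ! j}" unfolding W by auto
      moreover have sub: "{vs ! i, vs ! j} \<subseteq> ?C" using nth ij True by (auto simp: F_def)
      moreover have "card {vs ! i, vs ! j} = 2" using False nth_eq ij by simp
      moreover have "card {vs ! i, vs ! j} \<le> card ?C" using fin by (intro card_mono[OF _ sub]) auto
      ultimately have "real (card ?W) = k (F i) - 2"
        by (simp add: card_Diff_subset k of_nat_diff)
      then show ?thesis using ij True False by (simp add: CN_def N_def)
    next
      case diff: False
      then have "?W = {}" unfolding W by auto
      then have "card ?W = 0" by (simp only: card.empty)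
      then show ?thesis using ij diff False by (simp add: CN_def N_def)
    qed
  qed
  have row: "(\<Sum>j<N. CN \<G> vs $$ (i, j)) = (k (F i) - 1) * (k (F i) - 2)" if i: "i < N" for i
  proof -
    have "(\<Sum>j<N. CN \<G> vs $$ (i, j)) =
        (\<Sum>j<N. (if F j = F i then k (F i) - 2 else 0) - (if j = i then k (F i) - 2 else 0))"
      using i by (intro sum.cong) (auto simp: CN)
    also have "\<dots> = k (F i) * (k (F i) - 2) - (k (F i) - 2)"
      using i by (simp add: sum_subtractf sum.If_cases kF Int_def)
    finally show ?thesis by (simp add: algebra_simps)
  qed
  have dims: "CN \<G> vs \<in> carrier_mat N N" "CNRS \<G> vs \<in> carrier_mat N N"
    by (simp_all add: CN_def CNRS_def N_def)
  note dims' = dims[THEN carrier_matD(1)] dims[THEN carrier_matD(2)]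
  have RS: "CNRS \<G> vs $$ (i, j) = (if i = j then (k (F i) - 1) * (k (F i) - 2) else 0)"
    if "i < N" "j < N" for i j
    using that row by (simp add: CNRS_def mat_diag_def N_def[symmetric])
  have group: "(\<Sum>i<N. g (F i)) = (\<Sum>c\<in>S. k c * g c)" for g :: "'c \<Rightarrow> real"
  proof -
    have "(\<Sum>i<N. g (F i)) = (\<Sum>c\<in>S. \<Sum>i | i \<in> {..<N} \<and> F i = c. g (F i))"
      unfolding FS[symmetric] by (rule sum.image_gen) simp
    also have "\<dots> = (\<Sum>c\<in>S. \<Sum>i | i \<in> {..<N} \<and> F i = c. g c)"
      by (intro sum.cong) auto
    finally show ?thesis by (simp add: kF)
  qed
  have N: "real N = (\<Sum>c\<in>S. k c)" using group[of "\<lambda>_. 1"] by simp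
  then show "real (card (pverts \<G>)) = (\<Sum>c\<in>S. k c)"
    using distinct_card[OF vs(1)] vs(2) by (simp add: N_def)
  have "sum_list (diag_mat (CNRS \<G> vs)) = (\<Sum>i<N. CNRS \<G> vs $$ (i, i))"
    unfolding diag_mat_def dims' by (simp add: interv_sum_list_conv_sum_set_nat atLeast0LessThan)
  also have "\<dots> = (\<Sum>c\<in>S. k c * ((k c - 1) * (k c - 2)))"
    unfolding group[symmetric] by (intro sum.cong) (auto simp: RS)
  finally have Delta: "CN_Delta \<G> vs = d"
    by (simp add: CN_Delta_def d N N_def[symmetric] mult.assoc)
  \<comment> \<open>The block term also hits the diagonal. The diagonal term is therefore the row
    sum \<open>(k - 1) * (k - 2)\<close> minus the block entry: \<open>k * (k - 2)\<close> here, and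
    \<open>(k - 2)\<^sup>2\<close> for \<open>CNSL\<close>.\<close>
  have "CNL \<G> vs = mat N N (\<lambda>(i, j). (if i = j then (\<lambda>c. k c * (k c - 2)) (F i) else 0) +
      (if F i = F j then (\<lambda>c. - (k c - 2)) (F i) else 0))"
    by (rule eq_matI) (auto simp: CNL_def dims' CN RS algebra_simps)
  from spectral_deviation_block_matrix[OF this kF] have
    "LE_CN \<G> = (\<Sum>c\<in>S. \<bar>k c * (k c - 2) + k c * - (k c - 2) - d\<bar> + (k c - 1) * \<bar>k c * (k c - 2) - d\<bar>)"
    unfolding LE_CN_eq[OF vs] Delta FS .
  moreover have "k c * (k c - 2) + k c * - (k c - 2) = 0" for c
    by (simp add: algebra_simps)
  ultimately show "LE_CN \<G> = (\<Sum>c\<in>S. \<bar>d\<bar> + (k c - 1) * \<bar>k c * (k c - 2) - d\<bar>)"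
    by simp
  have "CNSL \<G> vs = mat N N (\<lambda>(i, j). (if i = j then (\<lambda>c. (k c - 2)\<^sup>2) (F i) else 0) +
      (if F i = F j then (\<lambda>c. k c - 2) (F i) else 0))"
    by (rule eq_matI) (auto simp: CNSL_def dims' CN RS algebra_simps power2_eq_square)
  from spectral_deviation_block_matrix[OF this kF] have
    "LE_CN_plus \<G> = (\<Sum>c\<in>S. \<bar>(k c - 2)\<^sup>2 + k c * (k c - 2) - d\<bar> + (k c - 1) * \<bar>(k c - 2)\<^sup>2 - d\<bar>)"
    unfolding LE_CN_plus_eq[OF vs] Delta FS .
  moreover have "(k c - 2)\<^sup>2 + k c * (k c - 2) = 2 * (k c - 1) * (k c - 2)" for c
    by (simp add: algebra_simps power2_eq_square)
  ultimately show "LE_CN_plus \<G> =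
      (\<Sum>c\<in>S. \<bar>2 * (k c - 1) * (k c - 2) - d\<bar> + (k c - 1) * \<bar>(k c - 2)\<^sup>2 - d\<bar>)"
    by simp
qed

section \<open>Central extensions of dihedral groups\<close>

lemma dihedral_mult [simp]:
  "(i, b) \<otimes>\<^bsub>dihedral_group n\<^esub> (j, c) = ((if b then i - j else i + j) mod int n, b \<noteq> c)"
  by (simp add: dihedral_group_def)

lemma dihedral_one [simp]: "\<one>\<^bsub>dihedral_group n\<^esub> = (0, False)"
  by (simp add: dihedral_group_def)

lemma dihedral_carrier [simp]: "carrier (dihedral_group n) = {0..<int n} \<times> UNIV"
  by (simp add: dihedral_group_def)

section \<open>Conjugacy classes and centralizers in an arbitrary group\<close>

context group
begin

lemma conj_class_eq_image:
  "x \<in> carrier G \<Longrightarrow> conj_class G x = (\<lambda>g. g \<otimes> x \<otimes> inv g) ` carrier G"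
  by (auto simp: conj_class_def orbit_def)

lemma conj_class_self: "x \<in> carrier G \<Longrightarrow> x \<in> conj_class G x"
  using group_action.orbit_refl[OF action_by_conjugation] by (simp add: conj_class_def)

lemma conj_class_disjoint:
  assumes "x \<in> carrier G" "y \<in> carrier G" "conj_class G x \<noteq> conj_class G y"
  shows "conj_class G x \<inter> conj_class G y = {}"
  using group_action.disjoint_union[OF action_by_conjugation] assms
  unfolding conj_class_def orbits_def by blast

lemma subgroup_centralizer:
  assumes "x \<in> carrier G"
  shows "subgroup {g \<in> carrier G. x \<otimes> g = g \<otimes> x} G"
proof (rule subgroupI)
  fix a b assume ab: "a \<in> {g \<in> carrier G. x \<otimes> g = g \<otimes> x}" "b \<in> {g \<in> carrier G. x \<otimes> g = g \<otimes> x}"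
  then have "x \<otimes> (a \<otimes> b) = (a \<otimes> x) \<otimes> b" using assms by (simp flip: m_assoc)
  also have "\<dots> = (a \<otimes> b) \<otimes> x" using ab assms by (simp add: m_assoc)
  finally show "a \<otimes> b \<in> {g \<in> carrier G. x \<otimes> g = g \<otimes> x}" using ab by simp
next
  fix a assume a: "a \<in> {g \<in> carrier G. x \<otimes> g = g \<otimes> x}"
  then have aG: "a \<in> carrier G" by simp
  then have "inv a \<otimes> x = inv a \<otimes> (x \<otimes> a) \<otimes> inv a" using assms by (simp add: m_assoc)
  also have "\<dots> = inv a \<otimes> (a \<otimes> x) \<otimes> inv a" using a by simp
  also have "\<dots> = x \<otimes> inv a" using aG assms by (simp flip: m_assoc)
  finally show "inv a \<in> {g \<in> carrier G. x \<otimes> g = g \<otimes> x}" using a by simp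
qed (use assms in auto)

text \<open>Orbit-stabilizer for the conjugation action, whose stabilizers are the
  centralizers.\<close>

lemma card_conj_class:
  assumes x: "x \<in> carrier G"
  shows "card (conj_class G x) * card {g \<in> carrier G. x \<otimes> g = g \<otimes> x} = order G"
proof -
  have "g \<otimes> x \<otimes> inv g = x \<longleftrightarrow> x \<otimes> g = g \<otimes> x" if g: "g \<in> carrier G" for g
  proof -
    have "x = g \<otimes> x \<otimes> inv g \<longleftrightarrow> g \<otimes> x = x \<otimes> g" by (rule inv_solve_right) (use g x in simp_all)
    then show ?thesis by metis
  qed
  then have "stabilizer G (\<lambda>g. \<lambda>h \<in> carrier G. g \<otimes> h \<otimes> inv g) x = {g \<in> carrier G. x \<otimes> g = g \<otimes> x}"
    using x by (auto simp: stabilizer_def)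
  then show ?thesis
    using group_action.orbit_stabilizer_theorem[OF action_by_conjugation x] by (simp add: conj_class_def)
qed

end

text \<open>The isomorphism from the quotient is replaced by a surjection defined on
  \<open>G\<close> with the centre as kernel, so that the arguments deal with elements rather than
  cosets.\<close>

locale central_dihedral_extension = group G for G (structure) +
  fixes n :: nat and \<phi> :: "'a \<Rightarrow> int \<times> bool"
  assumes fin: "finite (carrier G)"
    and n: "n \<ge> 3"
    and hom: "\<phi> \<in> hom G (dihedral_group n)"
    and surj: "\<phi> ` carrier G = carrier (dihedral_group n)"
    and kernel: "\<And>x. x \<in> carrier G \<Longrightarrow> \<phi> x = (0, False) \<longleftrightarrow> x \<in> group_center G"
begin

section \<open>Fibres of the projection, rotations, reflections and their centralizers\<close>

abbreviation "Z \<equiv> group_center G"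
abbreviation "z \<equiv> card Z"
abbreviation "rotations \<equiv> {x \<in> carrier G. \<not> snd (\<phi> x)}"

lemma Z_carrier: "Z \<subseteq> carrier G"
  by (auto simp: group_center_def)

lemma Z_commute: "u \<in> Z \<Longrightarrow> x \<in> carrier G \<Longrightarrow> u \<otimes> x = x \<otimes> u"
  by (simp add: group_center_def)

lemma \<phi>_range: "x \<in> carrier G \<Longrightarrow> fst (\<phi> x) \<in> {0..<int n}"
  using surj by (metis SigmaE dihedral_carrier fst_conv imageI)

lemma \<phi>_mult:
  assumes "x \<in> carrier G" "y \<in> carrier G"
  shows "\<phi> (x \<otimes> y) = ((if snd (\<phi> x) then fst (\<phi> x) - fst (\<phi> y) else fst (\<phi> x) + fst (\<phi> y)) mod int n,
    snd (\<phi> x) \<noteq> snd (\<phi> y))"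
proof -
  have "\<phi> (x \<otimes> y) = \<phi> x \<otimes>\<^bsub>dihedral_group n\<^esub> \<phi> y" using hom assms by (simp add: hom_mult)
  then show ?thesis by (cases "\<phi> x", cases "\<phi> y") simp
qed

lemma \<phi>_preimage:
  assumes "0 \<le> i" "i < int n"
  obtains x where "x \<in> carrier G" "\<phi> x = (i, b)"
proof -
  have "(i, b) \<in> \<phi> ` carrier G" using assms unfolding surj by simp
  then show ?thesis using that by auto
qed

lemma \<phi>_fibre:
  assumes x: "x \<in> carrier G" and y: "y \<in> carrier G" and eq: "\<phi> x = \<phi> y"
  obtains u where "u \<in> Z" "y = u \<otimes> x"
proof -
  have "group_hom G (dihedral_group n) \<phi>"
    using n hom by (auto intro!: group_hom.intro group_hom_axioms.intro group_dihedral_group)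
  then have "\<phi> (inv x) = inv\<^bsub>dihedral_group n\<^esub> \<phi> y"
    using x eq group_hom.hom_inv by metis
  then have "\<phi> (y \<otimes> inv x) = \<phi> y \<otimes>\<^bsub>dihedral_group n\<^esub> inv\<^bsub>dihedral_group n\<^esub> \<phi> y"
    using hom_mult[OF hom y, of "inv x"] x by simp
  also have "\<dots> = (0, False)"
    using group.r_inv[OF group_dihedral_group[of n], of "\<phi> y"] n hom_in_carrier[OF hom y] by simp
  finally have "\<phi> (y \<otimes> inv x) = (0, False)" .
  then have "y \<otimes> inv x \<in> Z" using kernel x y by simp
  moreover have "y = y \<otimes> inv x \<otimes> x" using x y by (simp add: m_assoc)
  ultimately show ?thesis using that by blast
qed

text \<open>Each fibre is a translate of \<open>Z\<close>. All later counts of elements of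
  \<open>G\<close> reduce through this to counts in the dihedral group.\<close>

lemma card_\<phi>_preimage:
  assumes S: "S \<subseteq> {0..<int n} \<times> UNIV"
  shows "card {x \<in> carrier G. \<phi> x \<in> S} = card S * z"
proof -
  have fibre: "card {x \<in> carrier G. \<phi> x = p} = z" if "p \<in> S" for p
  proof -
    have "0 \<le> fst p" "fst p < int n" using that S by auto
    then obtain x where x: "x \<in> carrier G" "\<phi> x = p"
      using \<phi>_preimage[of "fst p" "snd p"] by auto
    have "\<phi> (u \<otimes> x) = \<phi> x" if "u \<in> Z" for u
      using that kernel[of u] Z_carrier x(1) \<phi>_range[OF x(1)] by (auto simp: \<phi>_mult subset_iff)
    then have "{y \<in> carrier G. \<phi> y = p} = (\<lambda>u. u \<otimes> x) ` Z"
      using x Z_carrier by (auto simp: image_iff subset_iff elim: \<phi>_fibre[OF x(1)])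
    moreover have "inj_on (\<lambda>u. u \<otimes> x) Z"
      using x Z_carrier by (auto simp: inj_on_def subset_iff)
    ultimately show ?thesis by (simp add: card_image)
  qed
  have finS: "finite S" using S by (rule finite_subset) simp
  have "{x \<in> carrier G. \<phi> x \<in> S} = (\<Union>p\<in>S. {x \<in> carrier G. \<phi> x = p})" by auto
  also have "card \<dots> = (\<Sum>p\<in>S. card {x \<in> carrier G. \<phi> x = p})"
    using fin finS by (intro card_UN_disjoint) auto
  finally show ?thesis by (simp add: fibre)
qed

lemma order_eq: "order G = 2 * n * z"
proof -
  have "{x \<in> carrier G. \<phi> x \<in> {0..<int n} \<times> UNIV} = carrier G"
    using surj by auto
  then show ?thesis
    using card_\<phi>_preimage[of "{0..<int n} \<times> UNIV"] by (simp add: order_def card_cartesian_product)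
qed

lemma z_pos: "z > 0"
proof -
  have "\<one> \<in> Z" by (simp add: group_center_def)
  then show ?thesis using fin Z_carrier by (auto simp: card_gt_0_iff intro: finite_subset)
qed

text \<open>The powers of \<open>a\<close> reach every rotation of the dihedral group, and
  \<open>Z\<close> then fills up each fibre. It will be applied to centralizers.\<close>

lemma rotations_subset:
  assumes H: "subgroup H G" "Z \<subseteq> H" and a: "a \<in> H" "\<phi> a = (1, False)"
  shows "rotations \<subseteq> H"
proof
  have "\<exists>y\<in>H. \<phi> y = (int i mod int n, False)" for i
  proof (induction i)
    case 0
    have "\<one> \<in> Z" by (simp add: group_center_def)
    then show ?case using H kernel[of \<one>] by (auto intro!: bexI[of _ \<one>])
  next
    case (Suc i)
    then obtain y where y: "y \<in> H" "\<phi> y = (int i mod int n, False)" by blast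
    then have "\<phi> (y \<otimes> a) = (int (Suc i) mod int n, False)"
      using a H subgroup.subset[OF H(1)] by (subst \<phi>_mult) (auto simp: mod_simps add.commute)
    then show ?case using y a H by (intro bexI[of _ "y \<otimes> a"]) (auto simp: subgroup.m_closed)
  qed
  note powers = this
  fix x assume x: "x \<in> rotations"
  obtain y where y: "y \<in> H" "\<phi> y = \<phi> x"
    using powers[of "nat (fst (\<phi> x))"] x \<phi>_range[of x] by (cases "\<phi> x") auto
  then obtain u where "u \<in> Z" "x = u \<otimes> y"
    using x \<phi>_fibre[of y x] subgroup.subset[OF H(1)] by auto
  then show "x \<in> H" using y H by (auto simp: subgroup.m_closed)
qed

text \<open>The classical argument that a central extension of a cyclic group is abelian. The
  centralizer of a lift \<open>a\<close> of the generator contains all rotations; hence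
  \<open>a\<close> lies in the centralizer of any rotation \<open>x\<close>, which therefore
  contains all rotations too.\<close>

lemma rotations_commute:
  assumes "x \<in> rotations" "y \<in> rotations"
  shows "x \<otimes> y = y \<otimes> x"
proof -
  obtain a where a: "a \<in> carrier G" "\<phi> a = (1, False)"
    using \<phi>_preimage[of 1 False] n by auto
  have central: "Z \<subseteq> {g \<in> carrier G. w \<otimes> g = g \<otimes> w}" if "w \<in> carrier G" for w
    using that Z_carrier by (auto intro: Z_commute[symmetric])
  have "rotations \<subseteq> {g \<in> carrier G. a \<otimes> g = g \<otimes> a}"
    using a by (intro rotations_subset[OF subgroup_centralizer central]) auto
  then have x: "x \<in> carrier G" "x \<otimes> a = a \<otimes> x" using assms(1) by auto
  then have "rotations \<subseteq> {g \<in> carrier G. x \<otimes> g = g \<otimes> x}"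
    by (intro rotations_subset[OF subgroup_centralizer central _ a(2)]) (simp_all add: a(1))
  then show ?thesis using assms(2) by blast
qed

lemma reflection_quotient:
  assumes "g \<in> carrier G" "y \<in> carrier G" "snd (\<phi> g)" "snd (\<phi> y)"
  shows "g \<otimes> inv y \<in> rotations" "g = g \<otimes> inv y \<otimes> y"
proof -
  show *: "g = g \<otimes> inv y \<otimes> y" using assms by (simp add: m_assoc)
  have "snd (\<phi> (g \<otimes> inv y \<otimes> y)) = (snd (\<phi> (g \<otimes> inv y)) \<noteq> snd (\<phi> y))"
    using assms by (subst \<phi>_mult) auto
  then show "g \<otimes> inv y \<in> rotations" using assms *[symmetric] by auto
qed

text \<open>The centralizer of \<open>x\<close> contains all rotations and the reflection
  \<open>y\<close>. Every reflection is a rotation times \<open>y\<close>, so this centralizer is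
  all of \<open>G\<close>.\<close>

lemma rotation_reflection_commute:
  assumes x: "x \<in> rotations" and y: "y \<in> carrier G" "snd (\<phi> y)" and comm: "x \<otimes> y = y \<otimes> x"
  shows "x \<in> Z"
proof -
  have "x \<otimes> g = g \<otimes> x" if g: "g \<in> carrier G" for g
  proof (cases "snd (\<phi> g)")
    case True
    define h where "h = g \<otimes> inv y"
    have h: "h \<in> rotations" "g = h \<otimes> y"
      using reflection_quotient[OF g y(1) True y(2)] unfolding h_def by auto
    then have "h \<in> {g \<in> carrier G. x \<otimes> g = g \<otimes> x}" "y \<in> {g \<in> carrier G. x \<otimes> g = g \<otimes> x}"
      using rotations_commute[OF x] x y comm by auto
    then show ?thesis
      using subgroup.m_closed[OF subgroup_centralizer] x h(2) by blast
  next
    case False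
    then show ?thesis using rotations_commute x g by auto
  qed
  then show ?thesis using x by (auto simp: group_center_def)
qed

lemma centralizer_rotation:
  assumes "x \<in> rotations" "x \<notin> Z"
  shows "{g \<in> carrier G. x \<otimes> g = g \<otimes> x} = rotations"
proof
  show "{g \<in> carrier G. x \<otimes> g = g \<otimes> x} \<subseteq> rotations"
    using rotation_reflection_commute[OF assms(1)] assms(2) by auto
  show "rotations \<subseteq> {g \<in> carrier G. x \<otimes> g = g \<otimes> x}"
    using rotations_commute[OF assms(1)] by auto
qed

lemma same_fibre_commute:
  assumes "x \<in> carrier G" "y \<in> carrier G" "\<phi> x = \<phi> y"
  shows "x \<otimes> y = y \<otimes> x"
proof -
  obtain u where u: "u \<in> Z" "y = u \<otimes> x" using \<phi>_fibre assms by blast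
  then have "x \<otimes> y = (x \<otimes> u) \<otimes> x" using assms Z_carrier by (auto simp: m_assoc)
  also have "x \<otimes> u = u \<otimes> x" using u assms by (intro Z_commute[symmetric])
  finally show ?thesis using u by simp
qed

text \<open>The quotient \<open>y \<otimes> inv x\<close> is a rotation that commutes with the
  reflection \<open>x\<close>. It is therefore central, and \<phi> maps it to the identity.\<close>

lemma commuting_reflections:
  assumes "x \<in> carrier G" "y \<in> carrier G" "snd (\<phi> x)" "snd (\<phi> y)" and comm: "x \<otimes> y = y \<otimes> x"
  shows "\<phi> y = \<phi> x"
proof -
  define h where "h = y \<otimes> inv x"
  have h: "h \<in> rotations" "y = h \<otimes> x"
    using reflection_quotient[of y x] assms unfolding h_def by auto
  have C: "subgroup {g \<in> carrier G. x \<otimes> g = g \<otimes> x} G" by (rule subgroup_centralizer) fact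
  have "h \<in> {g \<in> carrier G. x \<otimes> g = g \<otimes> x}"
    unfolding h_def using assms by (intro subgroup.m_closed[OF C] subgroup.m_inv_closed[OF C]) auto
  then have "h \<in> Z" using rotation_reflection_commute[OF h(1), of x] assms by auto
  then have "\<phi> h = (0, False)" using kernel h by auto
  then show ?thesis
    using h \<phi>_mult[of h x] assms \<phi>_range[of x] by (auto simp: prod_eq_iff)
qed

lemma centralizer_reflection:
  assumes x: "x \<in> carrier G" "snd (\<phi> x)"
  shows "{g \<in> carrier G. x \<otimes> g = g \<otimes> x} = {g \<in> carrier G. \<phi> g \<in> {(0, False), \<phi> x}}"
proof -
  have "x \<otimes> g = g \<otimes> x \<longleftrightarrow> \<phi> g \<in> {(0, False), \<phi> x}" if g: "g \<in> carrier G" for g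
  proof (cases "snd (\<phi> g)")
    case True
    then show ?thesis
      using commuting_reflections[of x g] same_fibre_commute[of x g] x g by auto
  next
    case False
    then show ?thesis
      using rotation_reflection_commute[of g x] kernel[OF g] Z_commute[of g x] x g by auto
  qed
  then show ?thesis by blast
qed

lemma card_conj_class_rotation:
  assumes "x \<in> rotations" "x \<notin> Z"
  shows "card (conj_class G x) = 2"
proof -
  have "rotations = {g \<in> carrier G. \<phi> g \<in> {0..<int n} \<times> {False}}"
    using \<phi>_range by (auto simp: mem_Times_iff)
  then have "card rotations = n * z"
    using card_\<phi>_preimage[of "{0..<int n} \<times> {False}"] by (simp add: card_cartesian_product subset_iff)
  then have "card (conj_class G x) * (n * z) = 2 * (n * z)"
    using card_conj_class[of x] assms centralizer_rotation[OF assms] by (auto simp: order_eq)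
  then show ?thesis using n z_pos by simp
qed

lemma card_conj_class_reflection:
  assumes x: "x \<in> carrier G" "snd (\<phi> x)"
  shows "card (conj_class G x) = n"
proof -
  have "(0, False) \<noteq> \<phi> x" using x(2) by (metis snd_conv)
  then have "card {(0, False), \<phi> x} = 2" by simp
  then have "card {g \<in> carrier G. \<phi> g \<in> {(0, False), \<phi> x}} = 2 * z"
    using card_\<phi>_preimage[of "{(0, False), \<phi> x}"] \<phi>_range[OF x(1)] n by (auto simp: mem_Times_iff)
  then have "card (conj_class G x) * (2 * z) = n * (2 * z)"
    using card_conj_class[OF x(1)] centralizer_reflection[OF x] by (simp add: order_eq)
  then show ?thesis using z_pos by simp
qed

end

section \<open>Components of the graph and the number of classes in each\<close>

context central_dihedral_extension
begin

text \<open>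
  The connected components of the graph: the rotations, and one or two families of reflections
  according to the parity of \<open>n\<close>.
\<close>

definition component :: "int \<times> bool \<Rightarrow> nat" where
  "component p = (if \<not> snd p then 0 else if even n \<and> odd (fst p) then 2 else 1)"

text \<open>On conjugacy classes the chosen representative does not matter, by
  \<open>component_conj\<close>.\<close>

definition class_component :: "'a set \<Rightarrow> nat" where
  "class_component X = component (\<phi> (SOME x. x \<in> X))"

text \<open>Conjugation by a rotation shifts the exponent of a reflection by an even number, and
  conjugation by a reflection sends exponent \<open>i\<close> to \<open>2 * j - i\<close>. Both keep
  the parity, which is well defined modulo \<open>n\<close> when \<open>n\<close> is even.\<close>

lemma component_conj:
  assumes "x \<in> carrier G" "g \<in> carrier G"
  shows "component (\<phi> (g \<otimes> x \<otimes> inv g)) = component (\<phi> x)"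
proof -
  define w where "w = g \<otimes> x \<otimes> inv g"
  have w: "w \<in> carrier G" using assms by (simp add: w_def)
  \<comment> \<open>Comparing these two products avoids computing \<phi> of an inverse.\<close>
  have "w \<otimes> g = g \<otimes> x" using assms by (simp add: w_def m_assoc)
  then have eq: "\<phi> (w \<otimes> g) = \<phi> (g \<otimes> x)" by simp
  then have snd: "snd (\<phi> w) = snd (\<phi> x)"
    using assms w by (auto simp: \<phi>_mult)
  moreover have "even (fst (\<phi> w)) = even (fst (\<phi> x))" if "even n" "snd (\<phi> x)"
  proof -
    have parity: "even (i mod int n) = even i" for i using that by (simp add: dvd_mod_iff)
    have "(fst (\<phi> w) - fst (\<phi> g)) mod int n =
        (if snd (\<phi> g) then fst (\<phi> g) - fst (\<phi> x) else fst (\<phi> g) + fst (\<phi> x)) mod int n"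
      using eq assms w that snd by (simp add: \<phi>_mult)
    then have "even (fst (\<phi> w) - fst (\<phi> g)) =
        even (if snd (\<phi> g) then fst (\<phi> g) - fst (\<phi> x) else fst (\<phi> g) + fst (\<phi> x))"
      by (metis parity)
    then show ?thesis by (auto split: if_splits)
  qed
  ultimately show ?thesis by (auto simp: component_def w_def)
qed

lemma class_component_conj_class:
  assumes x: "x \<in> carrier G"
  shows "class_component (conj_class G x) = component (\<phi> x)"
proof -
  have "(SOME y. y \<in> conj_class G x) \<in> conj_class G x"
    using conj_class_self[OF x] by (rule someI)
  then show ?thesis
    using x by (auto simp: class_component_def conj_class_eq_image component_conj)
qed

text \<open>Conjugating by a rotation with exponent \<open>i\<close> adds \<open>2 * i\<close> to
  the exponent of a reflection. The congruence for \<open>i\<close> modulo \<open>n\<close> is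
  always solvable for odd \<open>n\<close>; for even \<open>n\<close> it needs an even difference of
  exponents, which equal components guarantee.\<close>

lemma conj_reflections_same_fibre:
  assumes x: "x \<in> carrier G" "snd (\<phi> x)" and y: "y \<in> carrier G" "snd (\<phi> y)"
    and component: "component (\<phi> x) = component (\<phi> y)"
  obtains g where "g \<in> carrier G" "\<phi> (g \<otimes> x \<otimes> inv g) = \<phi> y"
proof -
  have "\<exists>i. int n dvd 2 * i - (fst (\<phi> y) - fst (\<phi> x))"
  proof (cases "even n")
    case True
    then have "even (fst (\<phi> y) - fst (\<phi> x))"
      using component x y by (auto simp: component_def split: if_splits)
    then obtain i where "fst (\<phi> y) - fst (\<phi> x) = 2 * i" by (elim evenE)
    then show ?thesis by (intro exI[of _ i]) simp
  next
    case False
    then obtain m where "n = 2 * m + 1" by (elim oddE)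
    \<comment> \<open>The inverse of \<open>2\<close> modulo \<open>2 * m + 1\<close> is
      \<open>m + 1\<close>.\<close>
    then have "2 * ((fst (\<phi> y) - fst (\<phi> x)) * (int m + 1)) - (fst (\<phi> y) - fst (\<phi> x)) =
        int n * (fst (\<phi> y) - fst (\<phi> x))"
      by (simp add: algebra_simps)
    then show ?thesis by (metis dvd_triv_left)
  qed
  then obtain i where i: "int n dvd 2 * i - (fst (\<phi> y) - fst (\<phi> x))" by blast
  obtain g where g: "g \<in> carrier G" "\<phi> g = (i mod int n, False)"
    using \<phi>_preimage[of "i mod int n" False] n by auto
  define w where "w = g \<otimes> x \<otimes> inv g"
  have w: "w \<in> carrier G" using g x by (simp add: w_def)
  have "w \<otimes> g = g \<otimes> x" using g x by (simp add: w_def m_assoc)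
  then have eq: "\<phi> (w \<otimes> g) = \<phi> (g \<otimes> x)" by simp
  then have snd: "snd (\<phi> w)" using g w x by (auto simp: \<phi>_mult)
  then have "(fst (\<phi> w) - i) mod int n = (i + fst (\<phi> x)) mod int n"
    using eq g w x by (simp add: \<phi>_mult mod_simps)
  then have "int n dvd fst (\<phi> w) - i - (i + fst (\<phi> x))"
    by (simp add: mod_eq_dvd_iff)
  then have "int n dvd fst (\<phi> w) - i - (i + fst (\<phi> x)) + (2 * i - (fst (\<phi> y) - fst (\<phi> x)))"
    using i by (rule dvd_add)
  then have "int n dvd fst (\<phi> w) - fst (\<phi> y)" by simp
  then have "fst (\<phi> w) mod int n = fst (\<phi> y) mod int n"
    by (simp add: mod_eq_dvd_iff)
  then have "fst (\<phi> w) = fst (\<phi> y)"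
    using \<phi>_range[OF w] \<phi>_range[OF y(1)] by simp
  then have "\<phi> w = \<phi> y" using snd y by (simp add: prod_eq_iff)
  then show ?thesis using that g unfolding w_def by blast
qed

lemma noncentral_conj:
  assumes "x \<in> carrier G - Z" "g \<in> carrier G"
  shows "g \<otimes> x \<otimes> inv g \<in> carrier G - Z"
proof -
  define w where "w = g \<otimes> x \<otimes> inv g"
  have w: "w \<in> carrier G" using assms by (simp add: w_def)
  have "w \<notin> Z"
  proof
    assume "w \<in> Z"
    then have "g \<otimes> w = w \<otimes> g" using assms by (simp add: Z_commute)
    also have "\<dots> = g \<otimes> x" using assms by (simp add: w_def m_assoc)
    finally have "w = x" using assms w by simp
    then show False using assms \<open>w \<in> Z\<close> by simp
  qed
  then show ?thesis using w by (simp add: w_def)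
qed

lemma commuting_noncentral_component:
  assumes x: "x \<in> carrier G - Z" and y: "y \<in> carrier G - Z" and comm: "x \<otimes> y = y \<otimes> x"
  shows "component (\<phi> x) = component (\<phi> y)"
proof (cases "snd (\<phi> x)"; cases "snd (\<phi> y)")
  assume "snd (\<phi> x)" "snd (\<phi> y)"
  then show ?thesis using commuting_reflections[of x y] x y comm by simp
next
  \<comment> \<open>The two mixed cases are contradictory: a rotation commuting with a reflection
    would be central.\<close>
  assume "snd (\<phi> x)" "\<not> snd (\<phi> y)"
  then show ?thesis using rotation_reflection_commute[of y x] x y comm by simp
next
  assume "\<not> snd (\<phi> x)" "snd (\<phi> y)"
  then show ?thesis using rotation_reflection_commute[of x y] x y comm by simp
qed (simp add: component_def)

text \<open>Commuting noncentral elements share a component. Conversely, rotations commute, and a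
  reflection can be conjugated into the fibre of any other reflection of its component, where
  elements commute. This is the adjacency hypothesis of
  \<open>LE_CN_disjoint_cliques\<close>.\<close>

lemma ccc_graph_adjacency:
  assumes X: "X \<in> pverts (ccc_graph G)" and Y: "Y \<in> pverts (ccc_graph G)"
  shows "(X, Y) \<in> parcs (ccc_graph G) \<longleftrightarrow> X \<noteq> Y \<and> class_component X = class_component Y"
proof -
  from X Y obtain x y where x: "x \<in> carrier G - Z" "X = conj_class G x"
    and y: "y \<in> carrier G - Z" "Y = conj_class G y"
    by (auto simp: ccc_graph_def)
  have X': "x' \<in> carrier G - Z \<and> component (\<phi> x') = component (\<phi> x)" if "x' \<in> X" for x'
    using that x noncentral_conj[OF x(1)] by (auto simp: conj_class_eq_image component_conj)
  have Y': "y' \<in> carrier G - Z \<and> component (\<phi> y') = component (\<phi> y)" if "y' \<in> Y" for y'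
    using that y noncentral_conj[OF y(1)] by (auto simp: conj_class_eq_image component_conj)
  have "(\<exists>x'\<in>X. \<exists>y'\<in>Y. x' \<otimes> y' = y' \<otimes> x') \<longleftrightarrow> component (\<phi> x) = component (\<phi> y)"
  proof
    assume "\<exists>x'\<in>X. \<exists>y'\<in>Y. x' \<otimes> y' = y' \<otimes> x'"
    then show "component (\<phi> x) = component (\<phi> y)"
      using X' Y' commuting_noncentral_component by metis
  next
    assume eq: "component (\<phi> x) = component (\<phi> y)"
    have xX: "x \<in> X" and yY: "y \<in> Y" using x y conj_class_self by auto
    show "\<exists>x'\<in>X. \<exists>y'\<in>Y. x' \<otimes> y' = y' \<otimes> x'"
    proof (cases "snd (\<phi> x)")
      case False
      then have "\<not> snd (\<phi> y)" using eq by (auto simp: component_def split: if_splits)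
      then show ?thesis using rotations_commute[of x y] False x y xX yY by blast
    next
      case True
      then have "snd (\<phi> y)" using eq by (auto simp: component_def split: if_splits)
      then obtain g where g: "g \<in> carrier G" "\<phi> (g \<otimes> x \<otimes> inv g) = \<phi> y"
        using conj_reflections_same_fibre[of x y] True eq x y by auto
      then have "(g \<otimes> x \<otimes> inv g) \<otimes> y = y \<otimes> (g \<otimes> x \<otimes> inv g)"
        using x y by (intro same_fibre_commute) auto
      moreover have "g \<otimes> x \<otimes> inv g \<in> X" using x g by (simp add: conj_class_eq_image)
      ultimately show ?thesis using yY by blast
    qed
  qed
  moreover have "class_component X = component (\<phi> x)" "class_component Y = component (\<phi> y)"
    using x y by (simp_all add: class_component_conj_class)
  moreover have "(X, Y) \<in> parcs (ccc_graph G) \<longleftrightarrow> X \<noteq> Y \<and> (\<exists>x'\<in>X. \<exists>y'\<in>Y. x' \<otimes> y' = y' \<otimes> x')"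
    using X Y unfolding ccc_graph_def by simp
  ultimately show ?thesis by simp
qed

text \<open>The noncentral elements of a component are counted twice: by their partition into
  classes, of size \<open>2\<close> for rotations and \<open>n\<close> for reflections, and by
  fibres of size \<open>z\<close>. The point \<open>(0, False)\<close> is left out because its fibre
  is the centre.\<close>

lemma card_component_classes:
  "(if c = 0 then 2 else n) * card {X \<in> pverts (ccc_graph G). class_component X = c} =
    card {p \<in> {0..<int n} \<times> UNIV. p \<noteq> (0, False) \<and> component p = c} * z"
proof -
  let ?V = "{X \<in> pverts (ccc_graph G). class_component X = c}"
  have V: "\<exists>x. x \<in> carrier G - Z \<and> X = conj_class G x \<and> component (\<phi> x) = c" if "X \<in> ?V" for X
    using that by (auto simp: ccc_graph_def class_component_conj_class)
  have "\<Union>?V = {x \<in> carrier G. x \<notin> Z \<and> component (\<phi> x) = c}"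
  proof (intro equalityI subsetI)
    fix x assume "x \<in> \<Union>?V"
    then obtain X where "X \<in> ?V" "x \<in> X" by blast
    with V obtain y where y: "y \<in> carrier G - Z" "component (\<phi> y) = c" "x \<in> conj_class G y"
      by metis
    then show "x \<in> {x \<in> carrier G. x \<notin> Z \<and> component (\<phi> x) = c}"
      using noncentral_conj[OF y(1)] by (auto simp: conj_class_eq_image component_conj)
  next
    fix x assume x: "x \<in> {x \<in> carrier G. x \<notin> Z \<and> component (\<phi> x) = c}"
    then have "conj_class G x \<in> ?V" by (simp add: ccc_graph_def class_component_conj_class)
    moreover have "x \<in> conj_class G x" using x conj_class_self by simp
    ultimately show "x \<in> \<Union>?V" by blast
  qed
  also have "\<dots> = {x \<in> carrier G. \<phi> x \<in> {p \<in> {0..<int n} \<times> UNIV. p \<noteq> (0, False) \<and> component p = c}}"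
    using kernel \<phi>_range by (auto simp: mem_Times_iff)
  finally have union: "\<Union>?V = \<dots>" .
  have "(if c = 0 then 2 else n) * card ?V = card (\<Union>?V)"
  proof (rule card_partition)
    show "finite ?V" using fin by (simp add: ccc_graph_def)
    show "finite (\<Union>?V)" unfolding union using fin by simp
    show "card X = (if c = 0 then 2 else n)" if "X \<in> ?V" for X
      using V[OF that] card_conj_class_rotation card_conj_class_reflection
      by (auto simp: component_def split: if_splits)
    show "X \<inter> Y = {}" if "X \<in> ?V" "Y \<in> ?V" "X \<noteq> Y" for X Y
      using V[OF that(1)] V[OF that(2)] that(3) conj_class_disjoint by blast
  qed
  also have "\<dots> = card {p \<in> {0..<int n} \<times> UNIV. p \<noteq> (0, False) \<and> component p = c} * z"
    unfolding union by (rule card_\<phi>_preimage) auto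
  finally show ?thesis .
qed

lemma card_rotation_classes:
  "2 * card {X \<in> pverts (ccc_graph G). class_component X = 0} = (n - 1) * z"
proof -
  have "{p \<in> {0..<int n} \<times> UNIV. p \<noteq> (0, False) \<and> component p = 0} = {1..<int n} \<times> {False}"
    by (auto simp: component_def split: if_splits)
  moreover have "nat (int n - 1) = n - 1" by simp
  ultimately show ?thesis
    using card_component_classes[of 0] by (simp add: card_cartesian_product)
qed

lemma class_component_image:
  assumes "card {X \<in> pverts (ccc_graph G). class_component X = c} > 0"
  shows "c \<in> class_component ` pverts (ccc_graph G)"
proof -
  have "{X \<in> pverts (ccc_graph G). class_component X = c} \<noteq> {}"
    using assms by (metis card.empty less_irrefl)
  then show ?thesis by blast
qed

lemma rotation_component: "0 \<in> class_component ` pverts (ccc_graph G)"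
proof (rule class_component_image)
  have "(n - 1) * z > 0" using n z_pos by simp
  then show "card {X \<in> pverts (ccc_graph G). class_component X = 0} > 0"
    using card_rotation_classes by linarith
qed

lemma card_reflection_classes_odd:
  assumes "odd n"
  shows "card {X \<in> pverts (ccc_graph G). class_component X = 1} = z"
    and "class_component ` pverts (ccc_graph G) = {0, 1}"
proof -
  have "{p \<in> {0..<int n} \<times> UNIV. p \<noteq> (0, False) \<and> component p = 1} = {0..<int n} \<times> {True}"
    using assms by (auto simp: component_def split: if_splits)
  then show 1: "card {X \<in> pverts (ccc_graph G). class_component X = 1} = z"
    using card_component_classes[of 1] n by (simp add: card_cartesian_product)
  have "class_component ` pverts (ccc_graph G) \<subseteq> {0, 1}"
    using assms by (auto simp: class_component_def component_def)
  moreover have "1 \<in> class_component ` pverts (ccc_graph G)"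
    by (rule class_component_image) (use 1 z_pos in linarith)
  ultimately show "class_component ` pverts (ccc_graph G) = {0, 1}"
    using rotation_component by (intro equalityI) simp_all
qed

text \<open>Half of the \<open>n\<close> exponents are even and half are odd. Each parity accounts
  for \<open>n * z / 2\<close> elements in classes of size \<open>n\<close>. The equations without
  division also yield that \<open>z\<close> is even.\<close>

lemma card_reflection_classes_even:
  assumes "even n"
  shows "2 * card {X \<in> pverts (ccc_graph G). class_component X = 1} = z"
    and "2 * card {X \<in> pverts (ccc_graph G). class_component X = 2} = z"
    and "class_component ` pverts (ccc_graph G) = {0, 1, 2}"
proof -
  obtain m where m: "n = 2 * m" using assms by (elim evenE)
  have "{i \<in> {0..<int n}. even i} = (\<lambda>i. 2 * i) ` {0..<int m}"
    by (auto simp: m image_iff elim!: evenE)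
  then have evens: "card {i \<in> {0..<int n}. even i} = m" by (simp add: card_image inj_on_def)
  have "{i \<in> {0..<int n}. odd i} = (\<lambda>i. 2 * i + 1) ` {0..<int m}"
    by (auto simp: m image_iff elim!: oddE)
  then have odds: "card {i \<in> {0..<int n}. odd i} = m" by (simp add: card_image inj_on_def)
  have half: "2 * k = z" if "n * k = m * z" for k
  proof -
    have "m * (2 * k) = m * z" using that by (auto simp: m)
    then show ?thesis using n m by simp
  qed
  have "{p \<in> {0..<int n} \<times> UNIV. p \<noteq> (0, False) \<and> component p = 1} = {i \<in> {0..<int n}. even i} \<times> {True}"
    using assms by (auto simp: component_def split: if_splits)
  from card_component_classes[of 1, unfolded this card_cartesian_product evens]
  show 1: "2 * card {X \<in> pverts (ccc_graph G). class_component X = 1} = z"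
    by (intro half) simp
  have "{p \<in> {0..<int n} \<times> UNIV. p \<noteq> (0, False) \<and> component p = 2} = {i \<in> {0..<int n}. odd i} \<times> {True}"
    using assms by (auto simp: component_def split: if_splits)
  from card_component_classes[of 2, unfolded this card_cartesian_product odds]
  show 2: "2 * card {X \<in> pverts (ccc_graph G). class_component X = 2} = z"
    by (intro half) simp
  have "class_component ` pverts (ccc_graph G) \<subseteq> {0, 1, 2}"
    by (auto simp: class_component_def component_def)
  moreover have "1 \<in> class_component ` pverts (ccc_graph G)"
    by (rule class_component_image) (use 1 z_pos in linarith)
  moreover have "2 \<in> class_component ` pverts (ccc_graph G)"
    by (rule class_component_image) (use 2 z_pos in linarith)
  ultimately show "class_component ` pverts (ccc_graph G) = {0, 1, 2}"
    using rotation_component by (intro equalityI) simp_all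
qed

end

section \<open>Comparison with the complete graph\<close>

text \<open>This is the trace of \<open>CNRS\<close> for a clique on \<open>k\<close> vertices. For
  a graph of order \<open>N\<close>, twice \<open>falling3 N\<close> is \<open>N\<close> times the
  threshold for being hyperenergetic.\<close>

definition falling3 :: "real \<Rightarrow> real" where
  "falling3 k = k * (k - 1) * (k - 2)"

text \<open>
  The energies of the disjoint union of \<open>K\<^sub>p\<close> and \<open>r\<close> copies of \<open>K\<^sub>q\<close>.
\<close>

definition clique_Delta :: "real \<Rightarrow> real \<Rightarrow> real \<Rightarrow> real" where
  "clique_Delta r p q = (falling3 p + r * falling3 q) / (p + r * q)"

definition clique_LE :: "real \<Rightarrow> real \<Rightarrow> real \<Rightarrow> real" where
  "clique_LE r p q = (let d = clique_Delta r p q in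
     \<bar>d\<bar> + (p - 1) * \<bar>p * (p - 2) - d\<bar> + r * (\<bar>d\<bar> + (q - 1) * \<bar>q * (q - 2) - d\<bar>))"

definition clique_LE_plus :: "real \<Rightarrow> real \<Rightarrow> real \<Rightarrow> real" where
  "clique_LE_plus r p q = (let d = clique_Delta r p q in
     \<bar>2 * (p - 1) * (p - 2) - d\<bar> + (p - 1) * \<bar>(p - 2)\<^sup>2 - d\<bar> +
     r * (\<bar>2 * (q - 1) * (q - 2) - d\<bar> + (q - 1) * \<bar>(q - 2)\<^sup>2 - d\<bar>))"

text \<open>
  Both bounds arise by choosing signs for the absolute values: the nonzero eigenvalues
  coming from \<open>K\<^sub>p\<close> are counted as above the mean, the others as below the mean.
\<close>

lemma clique_LE_hyper:
  assumes r: "r \<ge> 0" and p: "p \<ge> 1" and q: "q \<ge> 1"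
    and bound: "falling3 (p + r * q) < falling3 p * (1 + r * q) - r * falling3 q * (p - 1)"
  shows "clique_LE r p q > 2 * (p + r * q - 1) * (p + r * q - 2)"
proof -
  define N where "N = p + r * q"
  define d where "d = clique_Delta r p q"
  have N: "N > 0" using assms by (simp add: N_def add_pos_nonneg)
  then have d: "N * d = falling3 p + r * falling3 q" by (simp add: d_def clique_Delta_def N_def)
  have "(p - 1) * (p * (p - 2) - d) \<le> (p - 1) * \<bar>p * (p - 2) - d\<bar>"
    using p by (intro mult_left_mono) auto
  moreover have "d - (q - 1) * (q * (q - 2) - d) \<le> \<bar>d\<bar> + (q - 1) * \<bar>q * (q - 2) - d\<bar>"
  proof -
    have "(q - 1) * (- (q * (q - 2) - d)) \<le> (q - 1) * \<bar>q * (q - 2) - d\<bar>"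
      using q by (intro mult_left_mono) auto
    then show ?thesis using abs_ge_self[of d] unfolding mult_minus_right by linarith
  qed
  then have "r * (d - (q - 1) * (q * (q - 2) - d)) \<le> r * (\<bar>d\<bar> + (q - 1) * \<bar>q * (q - 2) - d\<bar>)"
    using r by (rule mult_left_mono)
  ultimately have "d + (p - 1) * (p * (p - 2) - d) + r * (d - (q - 1) * (q * (q - 2) - d)) \<le> clique_LE r p q"
    unfolding clique_LE_def Let_def d_def[symmetric] by simp
  also have "d + (p - 1) * (p * (p - 2) - d) + r * (d - (q - 1) * (q * (q - 2) - d)) =
      falling3 p - r * falling3 q + (2 - p + r * q) * d"
    by (simp add: falling3_def algebra_simps)
  \<comment> \<open>Multiplication by \<open>N\<close> clears the denominator of the mean, leaving
    polynomials.\<close>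
  finally have le: "N * (falling3 p - r * falling3 q + (2 - p + r * q) * d) \<le> N * clique_LE r p q"
    using N by simp
  have "N * (2 * (N - 1) * (N - 2)) = 2 * falling3 N"
    by (simp add: falling3_def algebra_simps)
  also have "\<dots> < 2 * (falling3 p * (1 + r * q) - r * falling3 q * (p - 1))"
    using bound by (simp add: N_def)
  also have "\<dots> = N * (falling3 p - r * falling3 q) + (2 - p + r * q) * (N * d)"
    unfolding d by (simp add: N_def algebra_simps)
  also have "\<dots> = N * (falling3 p - r * falling3 q + (2 - p + r * q) * d)"
    by (simp add: algebra_simps)
  also note le
  finally have "N * (2 * (N - 1) * (N - 2)) < N * clique_LE r p q" .
  then show ?thesis using N by (simp add: N_def)
qed

lemma clique_LE_plus_hyper:
  assumes r: "r \<ge> 0" and p: "p \<ge> 1" and q: "q \<ge> 1"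
    and bound: "falling3 (p + r * q) < r * (q * falling3 p - p * falling3 q)"
  shows "clique_LE_plus r p q > 2 * (p + r * q - 1) * (p + r * q - 2)"
proof -
  define N where "N = p + r * q"
  define d where "d = clique_Delta r p q"
  have N: "N > 0" using assms by (simp add: N_def add_pos_nonneg)
  then have d: "N * d = falling3 p + r * falling3 q" by (simp add: d_def clique_Delta_def N_def)
  have "(p - 1) * ((p - 2)\<^sup>2 - d) \<le> (p - 1) * \<bar>(p - 2)\<^sup>2 - d\<bar>"
    using p by (intro mult_left_mono) auto
  moreover have "2 * (p - 1) * (p - 2) - d \<le> \<bar>2 * (p - 1) * (p - 2) - d\<bar>" by simp
  moreover have "d - 2 * (q - 1) * (q - 2) - (q - 1) * ((q - 2)\<^sup>2 - d) \<le>
      \<bar>2 * (q - 1) * (q - 2) - d\<bar> + (q - 1) * \<bar>(q - 2)\<^sup>2 - d\<bar>"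
  proof -
    have "(q - 1) * (- ((q - 2)\<^sup>2 - d)) \<le> (q - 1) * \<bar>(q - 2)\<^sup>2 - d\<bar>"
      using q by (intro mult_left_mono) auto
    moreover have "d - 2 * (q - 1) * (q - 2) \<le> \<bar>2 * (q - 1) * (q - 2) - d\<bar>" by simp
    ultimately show ?thesis unfolding mult_minus_right by linarith
  qed
  then have "r * (d - 2 * (q - 1) * (q - 2) - (q - 1) * ((q - 2)\<^sup>2 - d)) \<le>
      r * (\<bar>2 * (q - 1) * (q - 2) - d\<bar> + (q - 1) * \<bar>(q - 2)\<^sup>2 - d\<bar>)"
    using r by (rule mult_left_mono)
  ultimately have "2 * (p - 1) * (p - 2) - d + (p - 1) * ((p - 2)\<^sup>2 - d) +
      r * (d - 2 * (q - 1) * (q - 2) - (q - 1) * ((q - 2)\<^sup>2 - d)) \<le> clique_LE_plus r p q"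
    unfolding clique_LE_plus_def Let_def d_def[symmetric] by linarith
  also have "2 * (p - 1) * (p - 2) - d + (p - 1) * ((p - 2)\<^sup>2 - d) +
      r * (d - 2 * (q - 1) * (q - 2) - (q - 1) * ((q - 2)\<^sup>2 - d)) =
      falling3 p - r * falling3 q - (p - r * q) * d"
    by (simp add: falling3_def algebra_simps power2_eq_square)
  finally have le: "N * (falling3 p - r * falling3 q - (p - r * q) * d) \<le> N * clique_LE_plus r p q"
    using N by simp
  have "N * (2 * (N - 1) * (N - 2)) = 2 * falling3 N"
    by (simp add: falling3_def algebra_simps)
  also have "\<dots> < 2 * (r * (q * falling3 p - p * falling3 q))"
    using bound by (simp add: N_def)
  also have "\<dots> = N * (falling3 p - r * falling3 q) - (p - r * q) * (N * d)"
    unfolding d by (simp add: N_def algebra_simps)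
  also have "\<dots> = N * (falling3 p - r * falling3 q - (p - r * q) * d)"
    by (simp add: algebra_simps)
  also note le
  finally have "N * (2 * (N - 1) * (N - 2)) < N * clique_LE_plus r p q" .
  then show ?thesis using N by (simp add: N_def)
qed

lemma shift_lower_bounds:
  fixes c w :: real
  assumes "c \<ge> i \<and> w \<ge> j"
  obtains a b where "a \<ge> 0" "b \<ge> 0" "c = a + i" "w = b + j"
  using assms that[of "c - i" "w - j"] by simp

text \<open>
  After moving the corner of each of the regions to the origin, all coefficients of the difference
  of both sides are nonnegative.
\<close>

lemma falling3_bound_odd:
  fixes c w :: real
  assumes "c \<ge> 2 \<and> w \<ge> 4 \<or> c \<ge> 3 \<and> w \<ge> 2 \<or> c \<ge> 6 \<and> w \<ge> 1"
    and p: "p = c * w"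
  shows "falling3 (p + w) < falling3 p * (1 + w) - falling3 w * (p - 1)"
proof -
  from assms(1) consider
    a b where "a \<ge> 0" "b \<ge> 0" "c = a + 2" "w = b + 4" | a b where "a \<ge> 0" "b \<ge> 0" "c = a + 3" "w = b + 2" | a b where "a \<ge> 0" "b \<ge> 0" "c = a + 6" "w = b + 1"
    by (elim disjE) (erule shift_lower_bounds, blast)+
  then show ?thesis
    unfolding p falling3_def by cases (simp_all add: algebra_simps add_pos_nonneg add_nonneg_pos)
qed

lemma falling3_bound_plus_odd:
  fixes c w :: real
  assumes "c \<ge> 2 \<and> w \<ge> 5 \<or> c \<ge> 3 \<and> w \<ge> 3 \<or> c \<ge> 5 \<and> w \<ge> 2"
    and p: "p = c * w"
  shows "falling3 (p + w) < w * falling3 p - p * falling3 w"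
proof -
  from assms(1) consider
    a b where "a \<ge> 0" "b \<ge> 0" "c = a + 2" "w = b + 5" | a b where "a \<ge> 0" "b \<ge> 0" "c = a + 3" "w = b + 3" | a b where "a \<ge> 0" "b \<ge> 0" "c = a + 5" "w = b + 2"
    by (elim disjE) (erule shift_lower_bounds, blast)+
  then show ?thesis
    unfolding p falling3_def by cases (simp_all add: algebra_simps add_pos_nonneg add_nonneg_pos)
qed

text \<open>In the application \<open>n = 2 * c\<close> and \<open>z = 2 * w\<close>, so
  \<open>p\<close> is the number \<open>(n - 1) * z / 2\<close> of rotation classes and
  \<open>w\<close> the size of each of the two reflection cliques.\<close>

lemma falling3_bound_even:
  fixes c w :: real
  assumes "c \<ge> 2 \<and> w \<ge> 3 \<or> c \<ge> 3 \<and> w \<ge> 2 \<or> c \<ge> 4 \<and> w \<ge> 1"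
    and p: "p = (2 * c - 1) * w"
  shows "falling3 (p + 2 * w) < falling3 p * (1 + 2 * w) - 2 * falling3 w * (p - 1)"
proof -
  from assms(1) consider
    a b where "a \<ge> 0" "b \<ge> 0" "c = a + 2" "w = b + 3" | a b where "a \<ge> 0" "b \<ge> 0" "c = a + 3" "w = b + 2" | a b where "a \<ge> 0" "b \<ge> 0" "c = a + 4" "w = b + 1"
    by (elim disjE) (erule shift_lower_bounds, blast)+
  then show ?thesis
    unfolding p falling3_def by cases (simp_all add: algebra_simps add_pos_nonneg add_nonneg_pos)
qed

lemma falling3_bound_plus_even:
  fixes c w :: real
  assumes "c \<ge> 2 \<and> w \<ge> 3 \<or> c \<ge> 3 \<and> w \<ge> 2 \<or> c \<ge> 5 \<and> w \<ge> 1"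
    and p: "p = (2 * c - 1) * w"
  shows "falling3 (p + 2 * w) < 2 * (w * falling3 p - p * falling3 w)"
proof -
  from assms(1) consider
    a b where "a \<ge> 0" "b \<ge> 0" "c = a + 2" "w = b + 3" | a b where "a \<ge> 0" "b \<ge> 0" "c = a + 3" "w = b + 2" | a b where "a \<ge> 0" "b \<ge> 0" "c = a + 5" "w = b + 1"
    by (elim disjE) (erule shift_lower_bounds, blast)+
  then show ?thesis
    unfolding p falling3_def by cases (simp_all add: algebra_simps add_pos_nonneg add_nonneg_pos)
qed

section \<open>The infinite exceptional families: equal cliques, and a clique with an isolated
  vertex\<close>

lemma clique_LE_equal:
  assumes "q \<ge> 1"
  shows "clique_LE 1 q q = 4 * (q - 1) * \<bar>q - 2\<bar>"
    and "clique_LE_plus 1 q q = 4 * (q - 1) * \<bar>q - 2\<bar>"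
proof -
  \<comment> \<open>With equal cliques every row sum equals the mean, so subtracting the mean from
    \<open>CNL\<close> or \<open>CNSL\<close> leaves \<open>CN\<close> up to sign. Hence both
    energies agree. This is the case \<open>n = 3\<close>.\<close>
  have "falling3 q + 1 * falling3 q = (q + 1 * q) * ((q - 1) * (q - 2))"
    by (simp add: falling3_def algebra_simps)
  then have d: "clique_Delta 1 q q = (q - 1) * (q - 2)"
    using assms by (simp add: clique_Delta_def)
  have "q * (q - 2) - (q - 1) * (q - 2) = q - 2" by (simp add: algebra_simps)
  then show "clique_LE 1 q q = 4 * (q - 1) * \<bar>q - 2\<bar>"
    using assms unfolding clique_LE_def d Let_def by (simp add: abs_mult)
  have "(q - 2)\<^sup>2 - (q - 1) * (q - 2) = - (q - 2)"
    "2 * (q - 1) * (q - 2) - (q - 1) * (q - 2) = (q - 1) * (q - 2)"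
    by (simp_all add: algebra_simps power2_eq_square)
  then show "clique_LE_plus 1 q q = 4 * (q - 1) * \<bar>q - 2\<bar>"
    using assms unfolding clique_LE_plus_def d Let_def by (simp only: abs_mult abs_minus_cancel) simp
qed

text \<open>It reduces to \<open>\<bar>q - 2\<bar> \<le> 2 * q - 1\<close>. At \<open>q = 1\<close>
  both sides of the claim vanish, which is the borderenergetic case.\<close>

lemma clique_LE_equal_not_hyper:
  fixes q :: real
  assumes "q \<ge> 1"
  shows "4 * (q - 1) * \<bar>q - 2\<bar> \<le> 2 * (q + q - 1) * (q + q - 2)"
proof -
  have "4 * (q - 1) * \<bar>q - 2\<bar> \<le> 4 * (q - 1) * (2 * q - 1)"
    using assms by (intro mult_left_mono) auto
  then show ?thesis by (simp add: algebra_simps)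
qed

text \<open>This is the family \<open>z = 1\<close> with odd \<open>n \<ge> 5\<close>, where
  \<open>p + 1\<close> is the order of the graph. Here all signs are known, so the energy can be
  computed exactly; the final comparison is \<open>(p - 2) * (p + 2) < p * (p + 1)\<close>.\<close>

lemma clique_LE_plus_isolated:
  assumes "p \<ge> 2"
  shows "clique_LE_plus 1 p 1 < 2 * p * (p - 1)"
proof -
  define d where "d = clique_Delta 1 p 1"
  have d: "(p + 1) * d = falling3 p" using assms by (simp add: d_def clique_Delta_def falling3_def)
  \<comment> \<open>The eigenvalue of multiplicity \<open>p - 1\<close> does not exceed the mean,
    and its distance from it stays bounded as \<open>p\<close> grows.\<close>
  have pd: "(p - 2)\<^sup>2 - d = - (2 * (p - 2) / (p + 1))"
  proof -
    have "(p + 1) * ((p - 2)\<^sup>2 - d) = - 2 * (p - 2)"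
      by (simp add: right_diff_distrib d) (simp add: falling3_def algebra_simps power2_eq_square)
    then show ?thesis using assms by (simp add: field_simps)
  qed
  have "0 \<le> d" using assms by (simp add: d_def clique_Delta_def falling3_def)
  moreover have "2 * (p - 1) * (p - 2) - d \<ge> 0"
  proof -
    have "(p + 1) * (2 * (p - 1) * (p - 2) - d) = (p - 1) * (p - 2) * (p + 2)"
      by (simp add: right_diff_distrib d) (simp add: falling3_def algebra_simps)
    also have "\<dots> \<ge> 0" using assms by simp
    finally show ?thesis using assms by (simp add: zero_le_mult_iff)
  qed
  \<comment> \<open>The isolated vertex contributes \<open>d\<close>, which cancels the
    \<open>- d\<close> of the largest eigenvalue.\<close>
  ultimately have "clique_LE_plus 1 p 1 = 2 * (p - 1) * (p - 2) + (p - 1) * (2 * (p - 2) / (p + 1))"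
    using assms unfolding clique_LE_plus_def Let_def d_def[symmetric] pd by simp
  also have "\<dots> = 2 * (p - 1) * ((p - 2) * (p + 2) / (p + 1))"
    using assms by (simp add: field_simps)
  also have "\<dots> < 2 * (p - 1) * p"
    using assms by (intro mult_strict_left_mono) (auto simp: field_simps)
  finally show ?thesis by (simp add: mult_ac)
qed

text \<open>Apart from the family \<open>c = 1\<close> the exceptions are finitely many pairs, whose
  energies are evaluated explicitly.\<close>

lemma clique_LE_odd:
  fixes c z :: nat
  assumes "c \<ge> 1" "z \<ge> 1" and p: "p = real c * real z"
  shows "clique_LE 1 p z > 2 * (p + z - 1) * (p + z - 2) \<longleftrightarrow>
    \<not> (c = 1 \<or> c \<in> {2, 3, 4, 5} \<and> z = 1 \<or> c = 2 \<and> z \<in> {2, 3})"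
proof
  assume hyper: "clique_LE 1 p z > 2 * (p + z - 1) * (p + z - 2)"
  show "\<not> (c = 1 \<or> c \<in> {2, 3, 4, 5} \<and> z = 1 \<or> c = 2 \<and> z \<in> {2, 3})"
  proof
    assume exc: "c = 1 \<or> c \<in> {2, 3, 4, 5} \<and> z = 1 \<or> c = 2 \<and> z \<in> {2, 3}"
    have "c \<noteq> 1"
    proof
      assume "c = 1"
      then show False
        using hyper clique_LE_equal(1)[of z] clique_LE_equal_not_hyper[of z] assms by simp
    qed
    with exc show False
      using hyper by (auto simp: p clique_LE_def clique_Delta_def falling3_def Let_def power2_eq_square)
  qed
next
  assume "\<not> (c = 1 \<or> c \<in> {2, 3, 4, 5} \<and> z = 1 \<or> c = 2 \<and> z \<in> {2, 3})"
  \<comment> \<open>Among integer points, the complement of the exceptions is the union of the three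
    quadrants on which the polynomial bound holds.\<close>
  then have "c \<ge> 2 \<and> z \<ge> 4 \<or> c \<ge> 3 \<and> z \<ge> 2 \<or> c \<ge> 6 \<and> z \<ge> 1"
    using assms by auto
  then have "real c \<ge> 2 \<and> real z \<ge> 4 \<or> real c \<ge> 3 \<and> real z \<ge> 2 \<or> real c \<ge> 6 \<and> real z \<ge> 1"
    by linarith
  from falling3_bound_odd[OF this p] show "clique_LE 1 p z > 2 * (p + z - 1) * (p + z - 2)"
    using clique_LE_hyper[of 1 p z] assms by (simp add: mult_ge1_I)
qed

text \<open>Two infinite families, \<open>c = 1\<close> and \<open>z = 1\<close>, are excluded by
  the exact formula and the strict estimate above. The remaining exceptions are finitely many and
  evaluated explicitly.\<close>

lemma clique_LE_plus_odd:
  fixes c z :: nat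
  assumes "c \<ge> 1" "z \<ge> 1" and p: "p = real c * real z"
  shows "clique_LE_plus 1 p z > 2 * (p + z - 1) * (p + z - 2) \<longleftrightarrow>
    \<not> (c = 1 \<or> z = 1 \<or> c \<in> {2, 3, 4} \<and> z = 2 \<or> c = 2 \<and> z \<in> {3, 4})"
proof
  assume hyper: "clique_LE_plus 1 p z > 2 * (p + z - 1) * (p + z - 2)"
  show "\<not> (c = 1 \<or> z = 1 \<or> c \<in> {2, 3, 4} \<and> z = 2 \<or> c = 2 \<and> z \<in> {3, 4})"
  proof
    assume exc: "c = 1 \<or> z = 1 \<or> c \<in> {2, 3, 4} \<and> z = 2 \<or> c = 2 \<and> z \<in> {3, 4}"
    have "c \<noteq> 1"
    proof
      assume "c = 1"
      then show False
        using hyper clique_LE_equal(2)[of z] clique_LE_equal_not_hyper[of z] assms by simp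
    qed
    have "z \<noteq> 1"
    proof
      assume "z = 1"
      moreover have "real c \<ge> 2" using \<open>c \<noteq> 1\<close> assms by linarith
      ultimately show False
        using hyper clique_LE_plus_isolated[of c] by (simp add: p)
    qed
    with \<open>c \<noteq> 1\<close> exc show False
      using hyper by (auto simp: p clique_LE_plus_def clique_Delta_def falling3_def Let_def power2_eq_square)
  qed
next
  assume "\<not> (c = 1 \<or> z = 1 \<or> c \<in> {2, 3, 4} \<and> z = 2 \<or> c = 2 \<and> z \<in> {3, 4})"
  then have "c \<ge> 2 \<and> z \<ge> 5 \<or> c \<ge> 3 \<and> z \<ge> 3 \<or> c \<ge> 5 \<and> z \<ge> 2"
    using assms by auto
  then have "real c \<ge> 2 \<and> real z \<ge> 5 \<or> real c \<ge> 3 \<and> real z \<ge> 3 \<or> real c \<ge> 5 \<and> real z \<ge> 2"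
    by linarith
  from falling3_bound_plus_odd[OF this p] show "clique_LE_plus 1 p z > 2 * (p + z - 1) * (p + z - 2)"
    using clique_LE_plus_hyper[of 1 p z] assms by (simp add: mult_ge1_I)
qed

lemma clique_LE_even:
  fixes c w :: nat
  assumes "c \<ge> 2" "w \<ge> 1" and p: "p = (2 * real c - 1) * real w"
  shows "clique_LE 2 p w > 2 * (p + 2 * w - 1) * (p + 2 * w - 2) \<longleftrightarrow>
    \<not> (c \<in> {2, 3} \<and> w = 1 \<or> c = 2 \<and> w = 2)"
proof
  assume hyper: "clique_LE 2 p w > 2 * (p + 2 * w - 1) * (p + 2 * w - 2)"
  show "\<not> (c \<in> {2, 3} \<and> w = 1 \<or> c = 2 \<and> w = 2)"
  proof
    assume exc: "c \<in> {2, 3} \<and> w = 1 \<or> c = 2 \<and> w = 2"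
    then show False
      using hyper by (auto simp: p clique_LE_def clique_Delta_def falling3_def Let_def power2_eq_square)
  qed
next
  assume "\<not> (c \<in> {2, 3} \<and> w = 1 \<or> c = 2 \<and> w = 2)"
  then have "c \<ge> 2 \<and> w \<ge> 3 \<or> c \<ge> 3 \<and> w \<ge> 2 \<or> c \<ge> 4 \<and> w \<ge> 1"
    using assms by auto
  then have "real c \<ge> 2 \<and> real w \<ge> 3 \<or> real c \<ge> 3 \<and> real w \<ge> 2 \<or> real c \<ge> 4 \<and> real w \<ge> 1"
    by linarith
  from falling3_bound_even[OF this p] show "clique_LE 2 p w > 2 * (p + 2 * w - 1) * (p + 2 * w - 2)"
    using clique_LE_hyper[of 2 p w] assms by (simp add: mult_ge1_I)
qed

lemma clique_LE_plus_even:
  fixes c w :: nat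
  assumes "c \<ge> 2" "w \<ge> 1" and p: "p = (2 * real c - 1) * real w"
  shows "clique_LE_plus 2 p w > 2 * (p + 2 * w - 1) * (p + 2 * w - 2) \<longleftrightarrow>
    \<not> (c \<in> {2, 3, 4} \<and> w = 1 \<or> c = 2 \<and> w = 2)"
proof
  assume hyper: "clique_LE_plus 2 p w > 2 * (p + 2 * w - 1) * (p + 2 * w - 2)"
  show "\<not> (c \<in> {2, 3, 4} \<and> w = 1 \<or> c = 2 \<and> w = 2)"
  proof
    assume exc: "c \<in> {2, 3, 4} \<and> w = 1 \<or> c = 2 \<and> w = 2"
    then show False
      using hyper by (auto simp: p clique_LE_plus_def clique_Delta_def falling3_def Let_def power2_eq_square)
  qed
next
  assume "\<not> (c \<in> {2, 3, 4} \<and> w = 1 \<or> c = 2 \<and> w = 2)"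
  then have "c \<ge> 2 \<and> w \<ge> 3 \<or> c \<ge> 3 \<and> w \<ge> 2 \<or> c \<ge> 5 \<and> w \<ge> 1"
    using assms by auto
  then have "real c \<ge> 2 \<and> real w \<ge> 3 \<or> real c \<ge> 3 \<and> real w \<ge> 2 \<or> real c \<ge> 5 \<and> real w \<ge> 1"
    by linarith
  from falling3_bound_plus_even[OF this p] show "clique_LE_plus 2 p w > 2 * (p + 2 * w - 1) * (p + 2 * w - 2)"
    using clique_LE_plus_hyper[of 2 p w] assms by (simp add: mult_ge1_I)
qed

section \<open>The energies of the graph\<close>

context central_dihedral_extension
begin

lemma energies_odd:
  fixes c :: nat
  assumes c: "n = 2 * c + 1"
  defines "p \<equiv> real c * real z"
  shows "LE_CN (ccc_graph G) = clique_LE 1 p z"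
    and "LE_CN_plus (ccc_graph G) = clique_LE_plus 1 p z"
    and "real (card (pverts (ccc_graph G))) = p + z"
proof -
  define k where "k = (\<lambda>c. real (card {X \<in> pverts (ccc_graph G). class_component X = c}))"
  have n_odd: "odd n" by (simp add: c)
  have "card {X \<in> pverts (ccc_graph G). class_component X = 0} = c * z"
    using card_rotation_classes by (simp add: c)
  then have k: "k 0 = p" "k 1 = z"
    using card_reflection_classes_odd(1)[OF n_odd] by (simp_all add: k_def p_def)
  define d where "d = (\<Sum>c\<in>{0, 1}. k c * (k c - 1) * (k c - 2)) / (\<Sum>c\<in>{0, 1}. k c)"
  have d: "d = clique_Delta 1 p z"
    by (simp add: d_def k[simplified] clique_Delta_def falling3_def)
  have finV: "finite (pverts (ccc_graph G))" using fin by (simp add: ccc_graph_def)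
  note clique = LE_CN_disjoint_cliques[where k = k, OF finV ccc_graph_adjacency
      card_reflection_classes_odd(2)[OF n_odd] fun_cong[OF k_def] d_def]
  show "LE_CN (ccc_graph G) = clique_LE 1 p z"
    using clique(1) by (simp add: k[simplified] clique_LE_def d Let_def)
  show "LE_CN_plus (ccc_graph G) = clique_LE_plus 1 p z"
    using clique(2) by (simp add: k[simplified] clique_LE_plus_def d Let_def)
  show "real (card (pverts (ccc_graph G))) = p + z"
    using clique(3) by (simp add: k[simplified])
qed

lemma energies_even:
  fixes c w :: nat
  assumes c: "n = 2 * c" and w: "z = 2 * w"
  defines "p \<equiv> (2 * real c - 1) * real w"
  shows "LE_CN (ccc_graph G) = clique_LE 2 p w"
    and "LE_CN_plus (ccc_graph G) = clique_LE_plus 2 p w"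
    and "real (card (pverts (ccc_graph G))) = p + 2 * w"
proof -
  define k where "k = (\<lambda>c. real (card {X \<in> pverts (ccc_graph G). class_component X = c}))"
  have n_even: "even n" by (simp add: c)
  have "card {X \<in> pverts (ccc_graph G). class_component X = 0} = (2 * c - 1) * w"
    using card_rotation_classes by (simp add: c w)
  \<comment> \<open>The natural subtraction is not truncated, since \<open>n \<ge> 3\<close> makes
    \<open>c\<close> positive.\<close>
  moreover have "real (2 * c - 1) = 2 * real c - 1" using n c by (simp add: of_nat_diff)
  ultimately have k: "k 0 = p" "k 1 = w" "k 2 = w"
    using card_reflection_classes_even(1,2)[OF n_even] by (simp_all add: k_def p_def w)
  define d where "d = (\<Sum>c\<in>{0, 1, 2}. k c * (k c - 1) * (k c - 2)) / (\<Sum>c\<in>{0, 1, 2}. k c)"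
  have d: "d = clique_Delta 2 p w"
    by (simp add: d_def k[simplified] clique_Delta_def falling3_def)
  have finV: "finite (pverts (ccc_graph G))" using fin by (simp add: ccc_graph_def)
  note clique = LE_CN_disjoint_cliques[where k = k, OF finV ccc_graph_adjacency
      card_reflection_classes_even(3)[OF n_even] fun_cong[OF k_def] d_def]
  show "LE_CN (ccc_graph G) = clique_LE 2 p w"
    using clique(1) by (simp add: k[simplified] clique_LE_def d Let_def)
  show "LE_CN_plus (ccc_graph G) = clique_LE_plus 2 p w"
    using clique(2) by (simp add: k[simplified] clique_LE_plus_def d Let_def)
  show "real (card (pverts (ccc_graph G))) = p + 2 * w"
    using clique(3) by (simp add: k[simplified])
qed

lemma CNL_hyperenergetic_iff:
  "CNL_hyperenergetic (ccc_graph G) \<longleftrightarrow>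
      \<not> ((n \<in> {3, 11} \<and> z = 1) \<or>
         (n \<in> {4, 6} \<and> z = 2) \<or> (n = 4 \<and> z = 3) \<or> (n = 4 \<and> z = 4) \<or> (n = 3 \<and> z \<ge> 2) \<or>
         (n \<in> {5, 7, 9} \<and> z = 1) \<or> (n = 5 \<and> z \<in> {2, 3}))"
proof (cases "odd n")
  case True
  then obtain c where c: "n = 2 * c + 1" by (elim oddE)
  have "n = 3 \<longleftrightarrow> c = 1" "n = 5 \<longleftrightarrow> c = 2" "n = 7 \<longleftrightarrow> c = 3" "n = 9 \<longleftrightarrow> c = 4" "n = 11 \<longleftrightarrow> c = 5"
    "n = 4 \<longleftrightarrow> False" "n = 6 \<longleftrightarrow> False"
    using c by arith+
  note eqs = this
  \<comment> \<open>For \<open>n = 3\<close> the listed cases \<open>z = 1\<close> and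
    \<open>z \<ge> 2\<close> have to merge into the single family \<open>c = 1\<close>.\<close>
  have z_cases: "z = 1 \<or> z \<ge> 2" using z_pos by arith
  have "CNL_hyperenergetic (ccc_graph G) \<longleftrightarrow>
      \<not> (c = 1 \<or> c \<in> {2, 3, 4, 5} \<and> z = 1 \<or> c = 2 \<and> z \<in> {2, 3})"
    unfolding CNL_hyperenergetic_def energies_odd[OF c]
    by (rule clique_LE_odd) (use n z_pos c in auto)
  with z_cases show ?thesis unfolding insert_iff empty_iff eqs by blast
next
  case False
  then have n_even: "even n" by simp
  then obtain c where c: "n = 2 * c" by (elim evenE)
  obtain w where w: "z = 2 * w" using card_reflection_classes_even(1)[OF n_even] by metis
  \<comment> \<open>For even \<open>n\<close> the centre has even order, so every condition naming
    an odd \<open>z\<close> becomes false.\<close>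
  have "n = 4 \<longleftrightarrow> c = 2" "n = 6 \<longleftrightarrow> c = 3" "n = 8 \<longleftrightarrow> c = 4" "n = 3 \<longleftrightarrow> False" "n = 5 \<longleftrightarrow> False"
    "n = 7 \<longleftrightarrow> False" "n = 9 \<longleftrightarrow> False" "n = 11 \<longleftrightarrow> False"
    "z = 2 \<longleftrightarrow> w = 1" "z = 4 \<longleftrightarrow> w = 2" "z = 1 \<longleftrightarrow> False" "z = 3 \<longleftrightarrow> False" "z = 5 \<longleftrightarrow> False"
    using c w by arith+
  note eqs = this
  have "CNL_hyperenergetic (ccc_graph G) \<longleftrightarrow> \<not> (c \<in> {2, 3} \<and> w = 1 \<or> c = 2 \<and> w = 2)"
    unfolding CNL_hyperenergetic_def energies_even[OF c w]
    by (rule clique_LE_even) (use n z_pos c w in auto)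
  then show ?thesis unfolding insert_iff empty_iff eqs by blast
qed

lemma CNSL_hyperenergetic_iff:
  "CNSL_hyperenergetic (ccc_graph G) \<longleftrightarrow>
      \<not> ((n = 3 \<and> z = 1) \<or>
         (n = 4 \<and> z \<in> {2, 3, 4, 5}) \<or> (n \<in> {6, 8} \<and> z = 2) \<or> (n = 6 \<and> z = 3) \<or>
         (n = 5 \<and> z = 1) \<or> (n = 3 \<and> z \<ge> 2) \<or> (n \<ge> 7 \<and> odd n \<and> z = 1) \<or>
         (n \<in> {5, 7, 9} \<and> z = 2) \<or> (n = 5 \<and> z \<in> {3, 4}))"
proof (cases "odd n")
  case True
  then obtain c where c: "n = 2 * c + 1" by (elim oddE)
  have "n = 3 \<longleftrightarrow> c = 1" "n = 5 \<longleftrightarrow> c = 2" "n = 7 \<longleftrightarrow> c = 3" "n = 9 \<longleftrightarrow> c = 4" "n = 11 \<longleftrightarrow> c = 5"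
    "n = 4 \<longleftrightarrow> False" "n = 6 \<longleftrightarrow> False" "n = 8 \<longleftrightarrow> False" "n \<ge> 7 \<longleftrightarrow> c \<ge> 3"
    using c by arith+
  note eqs = this
  \<comment> \<open>The split on \<open>c\<close> merges the listed cases \<open>n = 3\<close>,
    \<open>n = 5\<close> and odd \<open>n \<ge> 7\<close> with \<open>z = 1\<close> into one
    family.\<close>
  have z_cases: "z = 1 \<or> z \<ge> 2" and c_cases: "c = 1 \<or> c = 2 \<or> c \<ge> 3" using z_pos c n by arith+
  have "CNSL_hyperenergetic (ccc_graph G) \<longleftrightarrow>
      \<not> (c = 1 \<or> z = 1 \<or> c \<in> {2, 3, 4} \<and> z = 2 \<or> c = 2 \<and> z \<in> {3, 4})"
    unfolding CNSL_hyperenergetic_def energies_odd[OF c]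
    by (rule clique_LE_plus_odd) (use n z_pos c in auto)
  with z_cases c_cases True show ?thesis unfolding insert_iff empty_iff eqs by blast
next
  case False
  then have n_even: "even n" by simp
  then obtain c where c: "n = 2 * c" by (elim evenE)
  obtain w where w: "z = 2 * w" using card_reflection_classes_even(1)[OF n_even] by metis
  have "n = 4 \<longleftrightarrow> c = 2" "n = 6 \<longleftrightarrow> c = 3" "n = 8 \<longleftrightarrow> c = 4" "n = 3 \<longleftrightarrow> False" "n = 5 \<longleftrightarrow> False"
    "n = 7 \<longleftrightarrow> False" "n = 9 \<longleftrightarrow> False" "n = 11 \<longleftrightarrow> False"
    "z = 2 \<longleftrightarrow> w = 1" "z = 4 \<longleftrightarrow> w = 2" "z = 1 \<longleftrightarrow> False" "z = 3 \<longleftrightarrow> False" "z = 5 \<longleftrightarrow> False"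
    using c w by arith+
  note eqs = this
  have "CNSL_hyperenergetic (ccc_graph G) \<longleftrightarrow> \<not> (c \<in> {2, 3, 4} \<and> w = 1 \<or> c = 2 \<and> w = 2)"
    unfolding CNSL_hyperenergetic_def energies_even[OF c w]
    by (rule clique_LE_plus_even) (use n z_pos c w in auto)
  then show ?thesis using False unfolding insert_iff empty_iff eqs by blast
qed

text \<open>For \<open>n = 3\<close> the graph is two isolated vertices, and energy and threshold
  are zero. For \<open>n = 11\<close> it is a 5-clique with an isolated vertex: the mean is
  \<open>10\<close>, and the deviations \<open>10\<close>, four times \<open>5\<close>, and
  \<open>10\<close> add up to the threshold \<open>40\<close>.\<close>

lemma CNL_borderenergetic:
  assumes "n \<in> {3, 11}" "z = 1"
  shows "CNL_borderenergetic (ccc_graph G)"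
proof -
  obtain c where c: "n = 2 * c + 1" "c \<in> {1, 5}"
    using assms that[of 1] that[of 5] by auto
  show ?thesis
    unfolding CNL_borderenergetic_def energies_odd[OF c(1)]
    using c(2) assms(2) by (auto simp: clique_LE_def clique_Delta_def falling3_def Let_def)
qed

lemma CNSL_borderenergetic:
  assumes "n = 3" "z = 1"
  shows "CNSL_borderenergetic (ccc_graph G)"
proof -
  have c: "n = 2 * 1 + 1" using assms by simp
  show ?thesis
    unfolding CNSL_borderenergetic_def energies_odd[OF c]
    using assms(2) by (simp add: clique_LE_plus_def clique_Delta_def falling3_def Let_def)
qed

end

section \<open>From the quotient isomorphism to the projection of the locale\<close>

lemma (in group) normal_center: "group_center G \<lhd> G"
proof (rule normal_invI)
  \<comment> \<open>The centre is the intersection of all centralizers, hence a subgroup; the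
    identity keeps the family nonempty.\<close>
  have "c \<in> group_center G \<longleftrightarrow> (\<forall>x\<in>carrier G. c \<in> {g \<in> carrier G. x \<otimes> g = g \<otimes> x})" for c
    unfolding group_center_def mem_Collect_eq using one_closed by metis
  then have "group_center G = (\<Inter>x\<in>carrier G. {g \<in> carrier G. x \<otimes> g = g \<otimes> x})"
    by blast
  moreover have "subgroup (\<Inter>x\<in>carrier G. {g \<in> carrier G. x \<otimes> g = g \<otimes> x}) G"
    by (rule subgroups_Inter) (use subgroup_centralizer in blast)+
  ultimately show "subgroup (group_center G) G" by simp
next
  fix x h assume x: "x \<in> carrier G" and h: "h \<in> group_center G"
  then have hG: "h \<in> carrier G" and comm: "x \<otimes> h = h \<otimes> x"
    unfolding group_center_def by auto
  have "x \<otimes> h \<otimes> inv x = h" unfolding comm using x hG by (simp add: m_assoc)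
  then show "x \<otimes> h \<otimes> inv x \<in> group_center G" using h by simp
qed

text \<open>The map \<phi> is the canonical projection followed by the isomorphism; injectivity of
  the latter makes the centre the exact kernel.\<close>

lemma obtain_central_dihedral_extension:
  fixes G (structure)
  assumes "group G" "finite (carrier G)" "n \<ge> 3" "G Mod group_center G \<cong> dihedral_group n"
  obtains \<phi> where "central_dihedral_extension G n \<phi>"
proof -
  interpret group G by fact
  have "group_center G \<lhd> G" by (rule normal_center)
  then interpret Z: normal "group_center G" G .
  obtain h where h: "h \<in> iso (G Mod group_center G) (dihedral_group n)"
    using assms(4) by (auto simp: is_iso_def)
  define \<phi> where "\<phi> = (\<lambda>x. h (group_center G #> x))"
  have D: "group (dihedral_group n)" using assms(3) by (intro group_dihedral_group) simp
  have carrier: "carrier (G Mod group_center G) = (\<lambda>x. group_center G #> x) ` carrier G"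
    by (rule carrier_FactGroup)
  have hom: "\<phi> \<in> hom G (dihedral_group n)"
    using Group.hom_compose[OF Z.r_coset_hom_Mod] h unfolding \<phi>_def iso_def o_def by blast
  have surj: "\<phi> ` carrier G = carrier (dihedral_group n)"
    using h unfolding \<phi>_def iso_def bij_betw_def carrier by (auto simp: image_image)
  have kernel: "\<phi> x = (0, False) \<longleftrightarrow> x \<in> group_center G" if x: "x \<in> carrier G" for x
  proof -
    have "h (group_center G) = (0, False)"
      using hom_one[of h "G Mod group_center G" "dihedral_group n"] h Z.factorgroup_is_group D
      by (simp add: iso_def)
    moreover have "group_center G \<in> carrier (G Mod group_center G)"
      using group.is_monoid[OF Z.factorgroup_is_group] monoid.one_closed by fastforce
    moreover have "group_center G #> x \<in> carrier (G Mod group_center G)"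
      using x carrier by blast
    moreover have "inj_on h (carrier (G Mod group_center G))"
      using h by (simp add: iso_def bij_betw_def)
    ultimately have "\<phi> x = (0, False) \<longleftrightarrow> group_center G #> x = group_center G"
      unfolding \<phi>_def by (metis inj_onD)
    also have "\<dots> \<longleftrightarrow> x \<in> group_center G"
      using x Z.is_subgroup coset_join1 coset_join2 Z.subset by metis
    finally show ?thesis .
  qed
  have "central_dihedral_extension G n \<phi>"
    using assms hom surj kernel by unfold_locales auto
  then show ?thesis by (rule that)
qed

theorem theorem3p4:
  fixes G :: "('a, 'b) monoid_scheme" and n z :: nat
  assumes "group G" and "finite (carrier G)" and "\<not> comm_group G"
    and "n \<ge> 3" and "G Mod group_center G \<cong> dihedral_group n"
    and "z = card (group_center G)"
  shows "(n \<in> {3, 11} \<and> z = 1 \<longrightarrow> CNL_borderenergetic (ccc_graph G)) \<and>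
    (CNL_hyperenergetic (ccc_graph G) \<longleftrightarrow>
      \<not> ((n \<in> {3, 11} \<and> z = 1) \<or>
         (n \<in> {4, 6} \<and> z = 2) \<or> (n = 4 \<and> z = 3) \<or> (n = 4 \<and> z = 4) \<or> (n = 3 \<and> z \<ge> 2) \<or>
         (n \<in> {5, 7, 9} \<and> z = 1) \<or> (n = 5 \<and> z \<in> {2, 3}))) \<and>
    (n = 3 \<and> z = 1 \<longrightarrow> CNSL_borderenergetic (ccc_graph G)) \<and>
    (CNSL_hyperenergetic (ccc_graph G) \<longleftrightarrow>
      \<not> ((n = 3 \<and> z = 1) \<or>
         (n = 4 \<and> z \<in> {2, 3, 4, 5}) \<or> (n \<in> {6, 8} \<and> z = 2) \<or> (n = 6 \<and> z = 3) \<or>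
         (n = 5 \<and> z = 1) \<or> (n = 3 \<and> z \<ge> 2) \<or> (n \<ge> 7 \<and> odd n \<and> z = 1) \<or>
         (n \<in> {5, 7, 9} \<and> z = 2) \<or> (n = 5 \<and> z \<in> {3, 4})))"
proof -
  obtain \<phi> where "central_dihedral_extension G n \<phi>"
    using obtain_central_dihedral_extension assms by blast
  then interpret central_dihedral_extension G n \<phi> .
  show ?thesis
    unfolding assms(6) CNL_hyperenergetic_iff CNSL_hyperenergetic_iff
    using CNL_borderenergetic CNSL_borderenergetic by simp
qed

end
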